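(* Let $\{\lambda_n\}_{n=1}^\infty$ be an admissible scale, and for $v\in\mathbb{R}$ and $n\ge1$ put $z=e^{2\pi v}$, $q=e^{-\pi\lambda_n^{-1}}$. Then, as $n\to\infty$, $$A_q(-q^{-4n}z)=\exp\left\{\pi\lambda_n\left(v+\frac{2n}{\lambda_n}\right)^2+\frac{\pi\lambda_n}{6}-\frac{\pi}{24\lambda_n}\right\}\frac{1}{\sqrt2}\left\{1+\mathcal{O}\left(e^{-\pi\lambda_n}\right)\right\}$$ and $$A_q(q^{-4n}z)=\exp\left\{\pi\lambda_n\left(v+\frac{2n}{\lambda_n}\right)^2-\frac{\pi\lambda_n}{12}-\frac{\pi}{24\lambda_n}\right\}\sqrt2\left\{\cos\pi\lambda_n v+\mathcal{O}\left(e^{-2\pi\lambda_n}\right)\right\},$$ where the $\mathcal{O}$-terms are uniform for $v$ in any compact subset of $\mathbb{R}$.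
   Context: An admissible scale is a sequence $\{\lambda_n\}_{n=1}^\infty$ of positive numbers such that $\lim_{n\to\infty}\lambda_n/\log n=\infty$ and $\lim_{n\to\infty} n/\lambda_n^2=\infty$. For $0<q<1$, $(a;q)_\infty:=\prod_{k=0}^\infty(1-aq^k)$. Ramanujan's entire function ($q$-Airy function) is $$A_q(w):=\frac{1}{(q;q)_\infty}\sum_{k=0}^\infty (q^{k+1};q)_\infty\, q^{k^2}(-w)^k=\sum_{k=0}^\infty\frac{q^{k^2}(-w)^k}{(q;q)_k},\qquad (q;q)_k:=\prod_{j=1}^{k}(1-q^j).$$ Note that $q$ depends on $n$. *)

theory Defs
  imports "HOL-Analysis.Analysis" "HOL-Library.Landau_Symbols"
begin

text \<open>Only the values \<open>lam n\<close> with \<open>n \<ge> 1\<close> matter; \<open>lam 0\<close> is unconstrained.\<close>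

definition admissible_scale :: "(nat \<Rightarrow> real) \<Rightarrow> bool" where
  "admissible_scale lam \<longleftrightarrow>
     (\<forall>n\<ge>1. lam n > 0) \<and>
     filterlim (\<lambda>n. lam n / ln (real n)) at_top sequentially \<and>
     filterlim (\<lambda>n. real n / (lam n)\<^sup>2) at_top sequentially"

definition qpochhammer_inf :: "complex \<Rightarrow> real \<Rightarrow> complex" where
  "qpochhammer_inf a q = (\<Prod>k. 1 - a * complex_of_real q ^ k)"

definition qpochhammer_fin :: "real \<Rightarrow> nat \<Rightarrow> real" where
  "qpochhammer_fin q k = (\<Prod>j=1..k. 1 - q ^ j)"

definition ramanujan_entire :: "real \<Rightarrow> complex \<Rightarrow> complex" where
  "ramanujan_entire q w =
     1 / qpochhammer_inf (of_real q) q *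
     (\<Sum>k. qpochhammer_inf (of_real q ^ (k + 1)) q * of_real q ^ (k\<^sup>2) * (- w) ^ k)"

lemma convergent_prod_qpochhammer_inf:
  assumes "0 < q" "q < 1"
  shows "convergent_prod (\<lambda>k. 1 - a * complex_of_real q ^ k)"
proof -
  have "summable (\<lambda>k. norm (- (a * complex_of_real q ^ k)))"
    using assms by (simp add: norm_mult norm_power summable_mult summable_geometric)
  then have "summable (\<lambda>k. norm ((1 - a * complex_of_real q ^ k) - 1))"
    by simp
  then show ?thesis
    by (intro abs_convergent_prod_imp_convergent_prod summable_imp_abs_convergent_prod)
qed

lemma qpochhammer_inf_split:
  assumes "0 < q" "q < 1"
  shows "qpochhammer_inf (of_real q) q =
         of_real (qpochhammer_fin q k) * qpochhammer_inf (of_real q ^ (k + 1)) q"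
proof -
  let ?f = "\<lambda>j. 1 - of_real q * complex_of_real q ^ j"
  have nz: "?f j \<noteq> 0" for j
  proof -
    have "q ^ Suc j < 1"
      using assms by (intro power_Suc_less_one) auto
    then have "complex_of_real (q ^ Suc j) \<noteq> 1"
      by (metis less_irrefl of_real_eq_1_iff)
    then show ?thesis by simp
  qed
  have "prodinf ?f = prod ?f {..<k} * (\<Prod>j. ?f (j + k))"
    using prodinf_split_initial_segment[OF convergent_prod_qpochhammer_inf[OF assms], of k "of_real q"] nz
    by (simp add: mult.commute)
  moreover have "prod ?f {..<k} = of_real (qpochhammer_fin q k)"
    unfolding qpochhammer_fin_def of_real_prod
    by (rule prod.reindex_bij_witness[of _ "\<lambda>j. j - 1" Suc]) auto
  moreover have "(\<lambda>j. ?f (j + k)) = (\<lambda>j. 1 - of_real q ^ (k + 1) * of_real q ^ j)"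
    by (simp add: fun_eq_iff power_add mult_ac)
  ultimately show ?thesis
    unfolding qpochhammer_inf_def by simp
qed

lemma qpochhammer_inf_self_nonzero:
  assumes "0 < q" "q < 1"
  shows "qpochhammer_inf (of_real q) q \<noteq> 0"
proof -
  have nz: "1 - of_real q * complex_of_real q ^ j \<noteq> 0" for j
  proof -
    have "q ^ Suc j < 1"
      using assms by (intro power_Suc_less_one) auto
    then have "complex_of_real (q ^ Suc j) \<noteq> 1"
      by (metis less_irrefl of_real_eq_1_iff)
    then show ?thesis by simp
  qed
  then show ?thesis
    unfolding qpochhammer_inf_def
    using prodinf_nonzero[OF convergent_prod_qpochhammer_inf[OF assms, of "of_real q"]] by blast
qed

lemma summable_ramanujan_entire:
  assumes "0 < q" "q < 1"
  shows "summable (\<lambda>k. of_real q ^ (k\<^sup>2) * (- w) ^ k / complex_of_real (qpochhammer_fin q k))"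
    (is "summable ?g")
proof -
  have "(\<lambda>k. q ^ k * (norm w / (1 - q))) \<longlonglongrightarrow> 0 * (norm w / (1 - q))"
    using assms by (intro tendsto_mult LIMSEQ_realpow_zero tendsto_const) auto
  then have "\<forall>\<^sub>F k in sequentially. q ^ k * (norm w / (1 - q)) < 1 / 2"
    by (rule order_tendstoD) simp
  then obtain N where N: "\<And>k. k \<ge> N \<Longrightarrow> q ^ k * (norm w / (1 - q)) < 1 / 2"
    unfolding eventually_sequentially by blast
  show ?thesis
  proof (rule summable_ratio_test[of "1 / 2" N])
    fix k assume k: "k \<ge> N"
    have lower: "1 - q \<le> 1 - q ^ Suc k"
      using assms power_decreasing[of 1 "Suc k" q] by simp
    have step: "?g (Suc k) =
        ?g k * (of_real (q ^ (2 * k + 1)) * (- w) / complex_of_real (1 - q ^ Suc k))"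
    proof -
      have "(Suc k)\<^sup>2 = k\<^sup>2 + (2 * k + 1)"
        by (simp add: power2_eq_square)
      moreover have "qpochhammer_fin q (Suc k) = qpochhammer_fin q k * (1 - q ^ Suc k)"
        by (simp add: qpochhammer_fin_def)
      ultimately show ?thesis
        by (simp only: power_add[of _ "k\<^sup>2"] power_Suc[of "- w"] of_real_mult of_real_power
            times_divide_times_eq mult_ac)
    qed
    have "norm (of_real (q ^ (2 * k + 1)) * (- w) / complex_of_real (1 - q ^ Suc k)) =
        q ^ (2 * k + 1) * norm w / (1 - q ^ Suc k)"
    proof -
      have "\<bar>1 - q ^ Suc k\<bar> = 1 - q ^ Suc k" "\<bar>q ^ (2 * k + 1)\<bar> = q ^ (2 * k + 1)"
        using assms lower by linarith (use assms in simp)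
      then show ?thesis
        by (simp only: norm_divide norm_mult norm_of_real norm_minus_cancel)
    qed
    also have "\<dots> \<le> q ^ k * norm w / (1 - q)"
      using assms lower power_decreasing[of k "2 * k + 1" q]
      by (intro frac_le mult_right_mono) auto
    also have "\<dots> \<le> 1 / 2"
      using N[OF k] by simp
    finally have "norm (?g k) * norm (of_real (q ^ (2 * k + 1)) * (- w) / complex_of_real (1 - q ^ Suc k))
        \<le> norm (?g k) * (1 / 2)"
      by (intro mult_left_mono) auto
    then show "norm (?g (Suc k)) \<le> 1 / 2 * norm (?g k)"
      unfolding step norm_mult by (simp add: mult.commute)
  qed auto
qed

lemma ramanujan_entire_eq:
  assumes "0 < q" "q < 1"
  shows "ramanujan_entire q w =
         (\<Sum>k. of_real q ^ (k\<^sup>2) * (- w) ^ k / of_real (qpochhammer_fin q k))"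
proof -
  let ?c = "qpochhammer_inf (of_real q) q"
  let ?g = "\<lambda>k. of_real q ^ (k\<^sup>2) * (- w) ^ k / complex_of_real (qpochhammer_fin q k)"
  have c: "?c \<noteq> 0"
    by (rule qpochhammer_inf_self_nonzero[OF assms])
  have t: "qpochhammer_inf (of_real q ^ (k + 1)) q * of_real q ^ (k\<^sup>2) * (- w) ^ k = ?c * ?g k" for k
    using qpochhammer_inf_split[OF assms, of k] c by auto
  have "(\<Sum>k. ?c * ?g k) = ?c * suminf ?g"
    by (rule suminf_mult[OF summable_ramanujan_entire[OF assms]])
  then show ?thesis
    unfolding ramanujan_entire_def t using c by simp
qed

end

theory Submission
  imports Defs "HOL-Probability.Characteristic_Functions"
begin

text \<open>
Write \<open>q = exp (- \<pi> / \<lambda>)\<close>. The term with index \<open>k\<close> of \<open>A\<^sub>q(\<mp> q^(-4n) z)\<close> is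
\<open>(\<plusminus>1)\<^sup>k q^(k\<^sup>2 - 4 n k) z\<^sup>k / (q;q)\<^sub>k\<close>. Completing the square shows that the series is
concentrated around \<open>k = 2 n\<close>, and since \<open>2 n\<close> is much larger than \<open>\<lambda>\<close> the
denominators there are practically \<open>(q;q)\<^sub>\<infinity>\<close>. Thus
\<open>A\<^sub>q(\<mp> q^(-4n) z)\<close> is, up to the explicit factor \<open>q^(-4 n\<^sup>2) z^(2 n)\<close>, the quotient
\<open>\<Sum>\<^sub>j (\<plusminus>1)\<^sup>j q^(j\<^sup>2) z\<^sup>j / (q;q)\<^sub>\<infinity>\<close> with a small perturbation. The identity is
\<open>ramanujan_series_eq_theta\<close>. The perturbation is controlled for all \<open>j\<close> simultaneously by
\<open>shifted_ratio_near_1\<close>: it is at most \<open>q^(2 n) / (1 - q)\<close> times a theta series with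
slightly shifted \<open>v\<close>. As \<open>n / \<lambda>\<^sup>2\<close> tends to infinity, \<open>q^(2 n)\<close> is smaller than
any fixed power of \<open>exp (- \<lambda>)\<close>; this and \<open>\<lambda> \<rightarrow> \<infinity>\<close> is what admissibility
provides.

The numerator is treated by inversion (\<open>theta_inversion\<close>), which converts slowly decaying
theta series for \<open>q\<close> near 1 into rapidly decaying ones: the ordinary series has the leading
term \<open>m = 0\<close> and next terms smaller by \<open>exp (- \<pi> \<lambda>)\<close>. The alternating series has the
two leading terms \<open>m = 0\<close> and \<open>m = 1\<close>, which add up to the cosine, and next terms smaller by
\<open>exp (- 2 \<pi> \<lambda>)\<close>. These are the two error terms of the theorem. The inversion is a case of
\<open>poisson_summation\<close>, proved here from the uniqueness of Fourier coefficients of continuous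
periodic functions (\<open>fourier_uniqueness\<close>) and the Fourier transform of the Gaussian.

The denominator needs no separate modular transformation. By \<open>pentagonal_number_theorem\<close>, obtained
as a limit of a finite identity of Shanks, \<open>(q;q)\<^sub>\<infinity>\<close> is itself a value of an
alternating theta series. The same inversion then gives
\<open>sqrt (2 \<lambda>) exp (\<pi> / (24 \<lambda>) - \<pi> \<lambda> / 6)\<close> up to a relative error
\<open>O(exp (- 2 \<pi> \<lambda>))\<close> (\<open>euler_function_asymptotics\<close>).
\<close>

section \<open>Continuous functions with vanishing Fourier coefficients\<close>

text \<open>Fourier coefficients on the unit interval, with all of them required to vanish. The class of such
functions is stable under multiplication by every polynomial in \<open>cos (2 \<pi> x)\<close> and
\<open>sin (2 \<pi> x)\<close>, which is how it interacts with the Stone-Weierstrass theorem.\<close>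

definition fourier_null :: "(real \<Rightarrow> complex) \<Rightarrow> bool" where
  "fourier_null H \<longleftrightarrow> (\<forall>m::int. ((\<lambda>x. H x * cis (2 * pi * m * x)) has_integral 0) {0..1})"

lemma fourier_null_add:
  "fourier_null F \<Longrightarrow> fourier_null G \<Longrightarrow> fourier_null (\<lambda>x. F x + G x)"
  unfolding fourier_null_def
proof
  fix m :: int
  assume "\<forall>m::int. ((\<lambda>x. F x * cis (2 * pi * m * x)) has_integral 0) {0..1}"
    and "\<forall>m::int. ((\<lambda>x. G x * cis (2 * pi * m * x)) has_integral 0) {0..1}"
  then show "((\<lambda>x. (F x + G x) * cis (2 * pi * m * x)) has_integral 0) {0..1}"
    using has_integral_add[of "\<lambda>x. F x * cis (2 * pi * m * x)" 0 "{0..1}"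
        "\<lambda>x. G x * cis (2 * pi * m * x)" 0]
    by (simp add: distrib_right)
qed

lemma fourier_null_scale:
  "fourier_null F \<Longrightarrow> fourier_null (\<lambda>x. c * F x)"
  unfolding fourier_null_def
  using has_integral_mult_right[of _ 0 "{0..1::real}" c] by (simp add: mult.assoc)

lemma fourier_null_shift:
  assumes "fourier_null F"
  shows "fourier_null (\<lambda>x. F x * cis (2 * pi * of_int k * x))"
  unfolding fourier_null_def
proof
  fix m :: int
  have "((\<lambda>x. F x * cis (2 * pi * of_int (k + m) * x)) has_integral 0) {0..1}"
    using assms unfolding fourier_null_def by blast
  also have "(\<lambda>x. F x * cis (2 * pi * of_int (k + m) * x))
      = (\<lambda>x. F x * cis (2 * pi * of_int k * x) * cis (2 * pi * of_int m * x))"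
    by (simp add: fun_eq_iff mult.assoc cis_mult algebra_simps)
  finally show "((\<lambda>x. F x * cis (2 * pi * of_int k * x) * cis (2 * pi * of_int m * x)) has_integral 0) {0..1}" .
qed

text \<open>Real polynomials in two variables, restricted to the unit circle, are trigonometric polynomials. A
linear form in \<open>cos\<close> and \<open>sin\<close> is a combination of two exponentials, that is of two
frequency shifts; products are handled by multiplying with one factor after the other, which is why
the function \<open>H\<close> is universally quantified in the induction.\<close>

lemma fourier_null_times_polynomial:
  assumes "real_polynomial_function p" "fourier_null H"
  shows "fourier_null (\<lambda>x. H x * of_real (p (cis (2 * pi * x))))"
  using assms
proof (induction arbitrary: H)
  case (linear f)
  define a b where "a = (complex_of_real (f 1) - \<i> * of_real (f \<i>)) / 2"
    and "b = (complex_of_real (f 1) + \<i> * of_real (f \<i>)) / 2"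
  have f: "f w = Re w * f 1 + Im w * f \<i>" for w
  proof -
    interpret bounded_linear f by fact
    have "w = Re w *\<^sub>R 1 + Im w *\<^sub>R \<i>"
      by (simp add: complex_eq_iff)
    then have "f w = f (Re w *\<^sub>R 1 + Im w *\<^sub>R \<i>)"
      by simp
    then show ?thesis
      by (simp add: add scaleR)
  qed
  have "fourier_null (\<lambda>x. a * (H x * cis (2 * pi * of_int 1 * x)) + b * (H x * cis (2 * pi * of_int (-1) * x)))"
    by (intro fourier_null_add fourier_null_scale fourier_null_shift linear)
  moreover have "a * (H x * cis (2 * pi * of_int 1 * x)) + b * (H x * cis (2 * pi * of_int (-1) * x))
      = H x * of_real (f (cis (2 * pi * x)))" for x
  proof -
    have "a * cis (2 * pi * x) + b * cis (- (2 * pi * x)) = of_real (f (cis (2 * pi * x)))"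
      unfolding f[of "cis (2 * pi * x)"] a_def b_def
      by (simp add: complex_eq_iff field_simps)
    then show ?thesis
      by (simp add: distrib_left[symmetric] mult.left_commute[of _ "H x"])
  qed
  ultimately show ?case by simp
next
  case (const c)
  then show ?case using fourier_null_scale[OF const, of c] by (simp add: mult.commute)
next
  case (add f g)
  then show ?case using fourier_null_add[OF add.IH(1)[OF add.prems] add.IH(2)[OF add.prems]]
    by (simp add: distrib_left)
next
  case (mult f g)
  then show ?case using mult.IH(2)[OF mult.IH(1)[OF mult.prems]]
    by (simp add: mult.assoc)
qed

lemma continuous_on_circle_of_loop:
  fixes g :: "real \<Rightarrow> 'a::real_normed_vector"
  assumes "continuous_on {0..1} g" "g 0 = g 1"
  shows "continuous_on (sphere 0 1) (\<lambda>z. g (Arg2pi z / (2 * pi)))"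
proof -
  have "homotopic_loops UNIV g g"
    using assms by (simp add: homotopic_loops_refl path_def pathstart_def pathfinish_def)
  from homotopic_with_imp_continuous[OF homotopic_loops_imp_homotopic_circlemaps[OF this]]
  show ?thesis by (simp add: o_def)
qed

text \<open>A continuous loop is a continuous function on the circle, so Stone-Weierstrass approximates it
uniformly by polynomials, against which \<open>H\<close> integrates to zero.\<close>

lemma fourier_null_orthogonal:
  fixes g :: "real \<Rightarrow> real"
  assumes H: "continuous_on {0..1} H" "fourier_null H"
    and g: "continuous_on {0..1} g" "g 0 = g 1"
  shows "integral {0..1} (\<lambda>x. H x * of_real (g x)) = 0"
proof -
  obtain B where B: "B > 0" "\<And>x. x \<in> {0..1} \<Longrightarrow> norm (H x) \<le> B"
    using compact_imp_bounded[OF compact_continuous_image[OF H(1)]]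
    by (auto simp: bounded_pos)
  have bound: "norm (integral {0..1} (\<lambda>x. H x * of_real (g x))) \<le> B * e" if e: "e > 0" for e
  proof -
    obtain p where p: "real_polynomial_function p"
        and pg: "\<And>z. z \<in> sphere (0::complex) 1 \<Longrightarrow> \<bar>g (Arg2pi z / (2 * pi)) - p z\<bar> < e"
      using Stone_Weierstrass_real_polynomial_function[OF compact_sphere continuous_on_circle_of_loop[OF g] e]
      by blast
    have close: "\<bar>g x - p (cis (2 * pi * x))\<bar> \<le> e" if x: "x \<in> {0..1}" for x
    proof (cases "x = 1")
      case True
      have "Arg2pi (cis 0) = 0" by (simp add: Arg2pi_of_real[of 1, simplified])
      then show ?thesis using pg[of "cis 0"] True g(2) by (simp add: less_imp_le Arg2pi_of_real)
    next
      case False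
      then have "Arg2pi (cis (2 * pi * x)) = 2 * pi * x"
        using x by (intro Arg2pi_unique[of 1]) (auto simp: cis_conv_exp)
      then show ?thesis using pg[of "cis (2 * pi * x)"] by (simp add: less_imp_le)
    qed
    have cp: "continuous_on {0..1} (\<lambda>x. p (cis (2 * pi * x)))"
      using continuous_on_polymonial_function[of p UNIV] p
      by (auto simp: real_polynomial_function_eq intro!: continuous_intros
          continuous_on_compose2[of UNIV p])
    have "((\<lambda>x. H x * of_real (p (cis (2 * pi * x)))) has_integral 0) {0..1}"
      using fourier_null_times_polynomial[OF p H(2)] unfolding fourier_null_def
      by (auto dest: spec[of _ "0::int"])
    moreover have "((\<lambda>x. H x * of_real (g x)) has_integral integral {0..1} (\<lambda>x. H x * of_real (g x))) {0..1}"
      by (intro integrable_integral integrable_continuous_real continuous_intros H g)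
    ultimately have "((\<lambda>x. H x * of_real (g x) - H x * of_real (p (cis (2 * pi * x)))) has_integral
        integral {0..1} (\<lambda>x. H x * of_real (g x)) - 0) {0..1}"
      by (rule has_integral_diff[rotated])
    then have "integral {0..1} (\<lambda>x. H x * of_real (g x))
        = integral {0..1} (\<lambda>x. H x * of_real (g x - p (cis (2 * pi * x))))"
      by (simp add: integral_unique right_diff_distrib)
    moreover have "norm (integral {0..1} (\<lambda>x. H x * of_real (g x - p (cis (2 * pi * x))))) \<le> B * e * (1 - 0)"
    proof (rule integral_bound)
      show "continuous_on {0..1} (\<lambda>x. H x * of_real (g x - p (cis (2 * pi * x))))"
        by (intro continuous_intros H g cp)
      show "norm (H x * of_real (g x - p (cis (2 * pi * x)))) \<le> B * e" if "x \<in> {0..1}" for x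
        unfolding norm_mult norm_of_real
        by (intro mult_mono B close that) (use B(1) in auto)
    qed simp
    ultimately show ?thesis by simp
  qed
  show ?thesis
  proof (rule ccontr)
    assume ne: "integral {0..1} (\<lambda>x. H x * of_real (g x)) \<noteq> 0"
    let ?I = "norm (integral {0..1} (\<lambda>x. H x * of_real (g x)))"
    have "?I \<le> B * (?I / (2 * B))"
      using ne B by (intro bound) auto
    then show False using ne B by simp
  qed
qed

text \<open>Orthogonality is applied to the real and the imaginary part of \<open>H\<close> itself, whose squares
therefore have integral zero.\<close>

theorem fourier_uniqueness:
  assumes H: "continuous_on {0..1} H" "H 0 = H 1" "fourier_null H"
    and x: "x \<in> {0..1}"
  shows "H x = 0"
proof -
  have int: "(\<lambda>x. H x * of_real (g x)) integrable_on {0..1}" if "continuous_on {0..1} g" for g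
    by (intro integrable_continuous_real continuous_intros H that)
  have "integral {0..1} (\<lambda>x. Re (H x) * Re (H x)) = Re (integral {0..1} (\<lambda>x. H x * of_real (Re (H x))))"
    using integral_linear[OF int bounded_linear_Re, of "\<lambda>x. Re (H x)"] H(1)
    by (simp add: o_def continuous_on_Re)
  also have "\<dots> = 0"
    using fourier_null_orthogonal[OF H(1,3), of "\<lambda>x. Re (H x)"] H(1,2) by (simp add: continuous_on_Re)
  finally have "\<forall>x\<in>{0..1}. Re (H x) * Re (H x) = 0"
    by (subst integral_eq_0_iff[symmetric]) (auto intro!: continuous_intros H)
  moreover have "integral {0..1} (\<lambda>x. Im (H x) * Im (H x)) = Im (integral {0..1} (\<lambda>x. H x * of_real (Im (H x))))"
    using integral_linear[OF int bounded_linear_Im, of "\<lambda>x. Im (H x)"] H(1)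
    by (simp add: o_def continuous_on_Im)
  then have "integral {0..1} (\<lambda>x. Im (H x) * Im (H x)) = 0"
    using fourier_null_orthogonal[OF H(1,3), of "\<lambda>x. Im (H x)"] H(1,2) by (simp add: continuous_on_Im)
  then have "\<forall>x\<in>{0..1}. Im (H x) * Im (H x) = 0"
    by (subst integral_eq_0_iff[symmetric]) (auto intro!: continuous_intros H)
  ultimately show ?thesis
    using x by (simp add: complex_eq_iff)
qed


section \<open>Poisson summation\<close>

text \<open>The next lemmas turn an integral over the line into a sum, over the integers, of integrals over
the unit interval: the intervals \<open>{-N..N}\<close> exhaust the line, and the sets \<open>{-N..<N}\<close>
of left endpoints exhaust the integers.\<close>

lemma has_integral_UNIV_imp_symmetric_limit:
  fixes g :: "real \<Rightarrow> complex"
  assumes "(g has_integral I) UNIV"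
  shows "(\<lambda>N. integral {- real N..real N} g) \<longlonglongrightarrow> I"
proof (rule LIMSEQ_I)
  fix e :: real assume "e > 0"
  then obtain B where B: "\<forall>a b. ball 0 B \<subseteq> cbox a b \<longrightarrow> norm (integral (cbox a b) g - I) < e"
    using assms unfolding has_integral_alt'[of g] by auto
  obtain N0 :: nat where N0: "B < real N0"
    using reals_Archimedean2 by blast
  show "\<exists>N0. \<forall>N\<ge>N0. norm (integral {- real N..real N} g - I) < e"
  proof (intro exI allI impI)
    fix N assume "N \<ge> N0"
    then have "ball 0 B \<subseteq> cbox (- real N) (real N)"
      using N0 by (auto simp: dist_real_def)
    then show "norm (integral {- real N..real N} g - I) < e"
      using B by force
  qed
qed

lemma sum_unit_interval_integrals:
  fixes g :: "real \<Rightarrow> complex"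
  assumes "continuous_on UNIV g"
  shows "(\<Sum>j\<in>{- int N..<int N}. integral {0..1} (\<lambda>x. g (x + of_int j))) = integral {- real N..real N} g"
proof (induction N)
  case (Suc N)
  have cont: "continuous_on S g" for S
    using assms continuous_on_subset by blast
  have int: "g integrable_on {a..b}" for a b
    by (intro integrable_continuous_real cont)
  have shift: "integral {0..1} (\<lambda>x. g (x + c)) = integral {c..1 + c} g" for c
    using integral_shift_Icc_real[of 0 1 g c] by (simp add: o_def add.commute)
  have "{- int (Suc N)..<int (Suc N)} = insert (- int N - 1) (insert (int N) {- int N..<int N})"
    by auto
  then have "(\<Sum>j\<in>{- int (Suc N)..<int (Suc N)}. integral {0..1} (\<lambda>x. g (x + of_int j)))
      = integral {- real N - 1..- real N} g + (integral {real N..real N + 1} g + integral {- real N..real N} g)"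
    using Suc.IH by (simp add: shift add.commute)
  also have "\<dots> = integral {- real N - 1..real N + 1} g"
  proof -
    have "integral {- real N - 1..- real N} g + integral {- real N..real N + 1} g = integral {- real N - 1..real N + 1} g"
      by (rule Henstock_Kurzweil_Integration.integral_combine[OF _ _ int]) auto
    moreover have "integral {- real N..real N} g + integral {real N..real N + 1} g = integral {- real N..real N + 1} g"
      by (rule Henstock_Kurzweil_Integration.integral_combine[OF _ _ int]) auto
    ultimately show ?thesis by (simp add: algebra_simps)
  qed
  moreover have "- real N - 1 = - real (Suc N)" "real N + 1 = real (Suc N)"
    by simp_all
  ultimately show ?case by (simp only:)
qed simp

lemma filterlim_finite_subsets_at_top_int:
  fixes S :: "nat \<Rightarrow> int set"
  assumes "\<And>N. finite (S N)" "\<And>N. {- int N..<int N} \<subseteq> S N"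
  shows "filterlim S (finite_subsets_at_top UNIV) sequentially"
proof (clarsimp simp: filterlim_finite_subsets_at_top assms(1))
  fix X :: "int set" assume fin: "finite X"
  define M where "M = nat (Max (insert 0 (abs ` X))) + 1"
  have "\<bar>j\<bar> < int M" if "j \<in> X" for j
  proof -
    have "\<bar>j\<bar> \<le> Max (insert 0 (abs ` X))" using that fin by (intro Max_ge) auto
    then show ?thesis unfolding M_def by linarith
  qed
  then have "X \<subseteq> S N" if "N \<ge> M" for N
    using that assms(2)[of N] by fastforce
  then show "\<forall>\<^sub>F N in sequentially. X \<subseteq> S N"
    unfolding eventually_sequentially by blast
qed

text \<open>Weierstrass' M-test in the form needed for termwise integration of a sum over an arbitrary index
set; both sides of the Poisson formula are such sums.\<close>

lemma integral_infsum_unit_interval: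
  fixes f :: "'i \<Rightarrow> real \<Rightarrow> complex"
  assumes cont: "\<And>j. continuous_on {0..1} (f j)"
    and bound: "\<And>j x. x \<in> {0..1} \<Longrightarrow> norm (f j x) \<le> M j" and M: "M summable_on UNIV"
  shows "continuous_on {0..1} (\<lambda>x. \<Sum>\<^sub>\<infinity>j. f j x)"
    and "((\<lambda>j. integral {0..1} (f j)) has_sum integral {0..1} (\<lambda>x. \<Sum>\<^sub>\<infinity>j. f j x)) UNIV"
proof -
  have lim: "uniform_limit {0..1} (\<lambda>X x. \<Sum>j\<in>X. f j x) (\<lambda>x. \<Sum>\<^sub>\<infinity>j. f j x) (finite_subsets_at_top UNIV)"
    by (rule Weierstrass_m_test_general[OF bound M])
  show "continuous_on {0..1} (\<lambda>x. \<Sum>\<^sub>\<infinity>j. f j x)"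
    by (rule uniform_limit_theorem[OF _ lim]) (auto intro!: always_eventually continuous_intros cont)
  obtain I J where I: "\<And>X. ((\<lambda>x. \<Sum>j\<in>X. f j x) has_integral I X) {0..1}"
      and J: "((\<lambda>x. \<Sum>\<^sub>\<infinity>j. f j x) has_integral J) {0..1}"
      and IJ: "(I \<longlongrightarrow> J) (finite_subsets_at_top UNIV)"
    by (rule uniform_limit_integral[OF lim]) (auto intro!: continuous_intros cont)
  have "I X = (\<Sum>j\<in>X. integral {0..1} (f j))" if "finite X" for X
    using I[of X] that cont
    by (subst integral_sum[symmetric]) (auto intro: integrable_continuous_real simp: integral_unique)
  then have "((\<lambda>X. \<Sum>j\<in>X. integral {0..1} (f j)) \<longlongrightarrow> J) (finite_subsets_at_top UNIV)"
    using IJ by (rule_tac Lim_transform_eventually) (auto intro: eventually_finite_subsets_at_top_weakI)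
  then show "((\<lambda>j. integral {0..1} (f j)) has_sum integral {0..1} (\<lambda>x. \<Sum>\<^sub>\<infinity>j. f j x)) UNIV"
    using J by (simp add: has_sum_def integral_unique)
qed

lemma cis_2pi_of_int_mult: "cis (2 * pi * of_int m * (x + of_int j)) = cis (2 * pi * of_int m * x)"
proof -
  have "2 * pi * of_int m * (x + of_int j) = 2 * pi * of_int m * x + 2 * pi * of_int (m * j)"
    by (simp add: algebra_simps)
  then have "cis (2 * pi * of_int m * (x + of_int j)) = cis (2 * pi * of_int m * x) * cis (2 * pi * of_int (m * j))"
    by (simp only: cis_mult)
  also have "cis (2 * pi * of_int (m * j)) = 1"
    by (rule cis_multiple_2pi) simp
  finally show ?thesis by simp
qed

lemma fourier_coefficient_orthogonality:
  "integral {0..1} (\<lambda>x. cis (2 * pi * of_int m * x)) = (if m = 0 then 1 else 0)"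
proof (cases "m = 0")
  case False
  have "((\<lambda>x. cis (2 * pi * of_int m * x)) has_integral
      cis (2 * pi * of_int m * 1) / (\<i> * (2 * pi * of_int m)) - cis (2 * pi * of_int m * 0) / (\<i> * (2 * pi * of_int m))) {0..1}"
  proof (rule fundamental_theorem_of_calculus)
    fix x :: real assume "x \<in> {0..1}"
    show "((\<lambda>x. cis (2 * pi * of_int m * x) / (\<i> * (2 * pi * of_int m))) has_vector_derivative cis (2 * pi * of_int m * x)) (at x within {0..1})"
      unfolding cis_conv_exp using False
      by (auto intro!: derivative_eq_intros has_vector_derivative_real_field simp: field_simps)
  qed simp
  moreover have "cis (2 * pi * of_int m) = 1"
    using cis_multiple_2pi[of "of_int m"] by simp
  ultimately show ?thesis using False by (simp add: integral_unique)
qed simp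

text \<open>The periodization \<open>F\<close> of \<open>f\<close> and the trigonometric series \<open>G\<close> are continuous
1-periodic functions with the same Fourier coefficients: for \<open>G\<close> by orthogonality of the
exponentials, for \<open>F\<close> because unfolding the sum turns the unit interval into the line.
Uniqueness then gives equality.\<close>

theorem poisson_summation:
  fixes f :: "real \<Rightarrow> complex" and c :: "int \<Rightarrow> complex"
  assumes cont: "continuous_on UNIV f"
    and bound: "\<And>j x. x \<in> {0..1} \<Longrightarrow> norm (f (x + of_int j)) \<le> M j" and M: "M summable_on UNIV"
    and fourier: "\<And>m. ((\<lambda>y. f y * cis (- (2 * pi * of_int m * y))) has_integral c m) UNIV"
    and c: "(\<lambda>m. norm (c m)) summable_on UNIV"
  shows "(\<Sum>\<^sub>\<infinity>j. f (x + of_int j)) = (\<Sum>\<^sub>\<infinity>m. c m * cis (2 * pi * of_int m * x))"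
proof -
  define F where "F = (\<lambda>x. \<Sum>\<^sub>\<infinity>j. f (x + of_int j))"
  define G where "G = (\<lambda>x. \<Sum>\<^sub>\<infinity>m. c m * cis (2 * pi * of_int m * x))"
  have contf: "continuous_on S f" for S
    using cont continuous_on_subset by blast
  have contfs: "continuous_on S (\<lambda>x. f (x + a))" for S a
    by (rule continuous_on_compose2[OF cont]) (auto intro!: continuous_intros)
  have F_shift: "F (x + of_int k) = F x" for x k
    unfolding F_def
    by (rule infsum_reindex_bij_witness[of _ "\<lambda>j. j - k" "\<lambda>j. j + k"]) (auto simp: add_ac)
  have G_shift: "G (x + of_int k) = G x" for x k
    unfolding G_def by (simp only: cis_2pi_of_int_mult)
  have contF: "continuous_on {0..1} F"
    unfolding F_def by (rule integral_infsum_unit_interval(1)[OF _ bound M]) (simp_all add: contfs)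
  have contG: "continuous_on {0..1} G"
    unfolding G_def
    by (rule integral_infsum_unit_interval(1)[OF _ _ c]) (auto simp: norm_mult intro!: continuous_intros)
  \<comment> \<open>Since exponentials of integral frequency are 1-periodic, they can be moved under the sum.\<close>
  have intF: "integral {0..1} (\<lambda>x. F x * cis (2 * pi * of_int m * x)) = c (- m)" for m
  proof -
    define g where "g = (\<lambda>y. f y * cis (2 * pi * of_int m * y))"
    have g: "g (x + of_int j) = f (x + of_int j) * cis (2 * pi * of_int m * x)" for x j
      unfolding g_def by (simp only: cis_2pi_of_int_mult)
    have cg: "continuous_on UNIV g"
      unfolding g_def by (intro continuous_intros contf)
    have "((\<lambda>j. integral {0..1} (\<lambda>x. g (x + of_int j))) has_sum
        integral {0..1} (\<lambda>x. \<Sum>\<^sub>\<infinity>j. g (x + of_int j))) UNIV"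
      by (rule integral_infsum_unit_interval(2)[OF _ _ M])
        (auto simp: g norm_mult bound intro!: continuous_intros contfs)
    moreover have "(\<Sum>\<^sub>\<infinity>j. g (x + of_int j)) = F x * cis (2 * pi * of_int m * x)" for x
      unfolding g F_def by (rule infsum_cmult_left')
    ultimately have "((\<lambda>j. integral {0..1} (\<lambda>x. g (x + of_int j))) has_sum
        integral {0..1} (\<lambda>x. F x * cis (2 * pi * of_int m * x))) UNIV"
      by simp
    then have "(\<lambda>N. \<Sum>j\<in>{- int N..<int N}. integral {0..1} (\<lambda>x. g (x + of_int j)))
        \<longlonglongrightarrow> integral {0..1} (\<lambda>x. F x * cis (2 * pi * of_int m * x))"
      unfolding has_sum_def
      by (rule filterlim_compose[OF _ filterlim_finite_subsets_at_top_int]) auto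
    moreover have "(g has_integral c (- m)) UNIV"
      using fourier[of "- m"] by (simp add: g_def)
    from has_integral_UNIV_imp_symmetric_limit[OF this]
    have "(\<lambda>N. \<Sum>j\<in>{- int N..<int N}. integral {0..1} (\<lambda>x. g (x + of_int j))) \<longlonglongrightarrow> c (- m)"
      by (simp add: sum_unit_interval_integrals[OF cg])
    ultimately show ?thesis using LIMSEQ_unique by blast
  qed
  have intG: "integral {0..1} (\<lambda>x. G x * cis (2 * pi * of_int m * x)) = c (- m)" for m
  proof -
    have e: "c k * cis (2 * pi * of_int k * x) * cis (2 * pi * of_int m * x) = c k * cis (2 * pi * of_int (k + m) * x)" for k x
      by (simp add: mult.assoc cis_mult algebra_simps)
    have "((\<lambda>k. integral {0..1} (\<lambda>x. c k * cis (2 * pi * of_int (k + m) * x))) has_sum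
        integral {0..1} (\<lambda>x. \<Sum>\<^sub>\<infinity>k. c k * cis (2 * pi * of_int (k + m) * x))) UNIV"
      by (rule integral_infsum_unit_interval(2)[OF _ _ c]) (auto simp: norm_mult intro!: continuous_intros)
    moreover have "(\<Sum>\<^sub>\<infinity>k. c k * cis (2 * pi * of_int (k + m) * x)) = G x * cis (2 * pi * of_int m * x)" for x
      unfolding e[symmetric] G_def by (rule infsum_cmult_left')
    moreover have "integral {0..1} (\<lambda>x. c k * cis (2 * pi * of_int (k + m) * x)) = (if k = - m then c k else 0)" for k
      unfolding integral_mult_right fourier_coefficient_orthogonality by auto
    ultimately have "((\<lambda>k. if k = - m then c k else 0) has_sum
        integral {0..1} (\<lambda>x. G x * cis (2 * pi * of_int m * x))) UNIV"
      by simp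
    moreover have "((\<lambda>k. if k = - m then c k else 0) has_sum c (- m)) UNIV"
      by (rule has_sum_finite_neutralI[of "{- m}"]) auto
    ultimately show ?thesis by (rule has_sum_unique)
  qed
  have null: "fourier_null (\<lambda>x. F x - G x)"
    unfolding fourier_null_def
  proof
    fix m :: int
    have "((\<lambda>x. F x * cis (2 * pi * m * x) - G x * cis (2 * pi * m * x)) has_integral (c (- m) - c (- m))) {0..1}"
      by (intro has_integral_diff) (auto simp: has_integral_iff intF intG intro!: integrable_continuous_real continuous_intros contF contG)
    then show "((\<lambda>x. (F x - G x) * cis (2 * pi * m * x)) has_integral 0) {0..1}"
      by (simp add: left_diff_distrib)
  qed
  have *: "F x - G x = 0" if "x \<in> {0..1}" for x
    using F_shift[of 0 1] G_shift[of 0 1] that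
    by (intro fourier_uniqueness[OF _ _ null]) (auto intro!: continuous_intros contF contG)
  have "F x = F (frac x + of_int \<lfloor>x\<rfloor>)" "G x = G (frac x + of_int \<lfloor>x\<rfloor>)"
    by (simp_all add: frac_def)
  then have "F x = F (frac x)" "G x = G (frac x)"
    by (simp_all only: F_shift G_shift)
  moreover have "F (frac x) - G (frac x) = 0"
    by (rule *) (simp add: frac_ge_0 less_imp_le[OF frac_lt_1])
  ultimately show ?thesis by (simp add: F_def G_def)
qed

section \<open>Inversion of theta series\<close>

text \<open>A rescaling of the characteristic function of the standard normal distribution.\<close>

lemma has_integral_gaussian_fourier:
  assumes t: "t > 0"
  shows "((\<lambda>y. of_real (exp (- (pi * t * y\<^sup>2))) * cis (- (2 * pi * b * y))) has_integral
           complex_of_real (exp (- (pi * b\<^sup>2 / t)) / sqrt t)) UNIV"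
proof -
  define c where "c = sqrt (2 * pi * t)"
  define s where "s = - (2 * pi * b / c)"
  define h where "h = (\<lambda>x. std_normal_density x *\<^sub>R iexp (s * x))"
  have c: "c > 0" "c\<^sup>2 = 2 * pi * t"
    using t by (simp_all add: c_def)
  have "integrable lborel (\<lambda>x. norm (h x))"
    using integrable_normal_density[of 1 0] by (simp add: h_def normal_density_nonneg)
  then have int: "integrable lborel h"
    by (subst integrable_norm_iff[symmetric]) (simp_all add: h_def)
  have "integral\<^sup>L lborel h = char std_normal_distribution s"
    unfolding char_def h_def by (subst integral_density) (auto simp: normal_density_nonneg)
  also have "\<dots> = of_real (exp (- (s\<^sup>2) / 2))"
    by (simp add: char_std_normal_distribution)
  finally have "has_bochner_integral lborel h (of_real (exp (- (s\<^sup>2) / 2)))"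
    using int by (simp add: has_bochner_integral_iff)
  then have "has_bochner_integral lborel (\<lambda>x. h (0 + c * x)) (of_real (exp (- (s\<^sup>2) / 2)) /\<^sub>R \<bar>c\<bar>)"
    using c by (subst (asm) lborel_has_bochner_integral_real_affine_iff[of c _ _ 0]) auto
  then have "integrable lborel (\<lambda>x. h (c * x))"
    and "integral\<^sup>L lborel (\<lambda>x. h (c * x)) = of_real (exp (- (s\<^sup>2) / 2)) /\<^sub>R c"
    using c(1) by (simp_all add: has_bochner_integral_iff)
  then have "((\<lambda>x. h (c * x)) has_integral (of_real (exp (- (s\<^sup>2) / 2)) /\<^sub>R c)) UNIV"
    using has_integral_integral_lborel by metis
  then have "((\<lambda>x. of_real (sqrt (2 * pi)) * h (c * x)) has_integral
      of_real (sqrt (2 * pi)) * (of_real (exp (- (s\<^sup>2) / 2)) /\<^sub>R c)) UNIV"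
    by (rule has_integral_mult_right)
  also have "of_real (sqrt (2 * pi)) * (of_real (exp (- (s\<^sup>2) / 2)) /\<^sub>R c) = complex_of_real (exp (- (pi * b\<^sup>2 / t)) / sqrt t)"
  proof -
    have "- (s\<^sup>2) / 2 = - (pi * b\<^sup>2 / t)"
      using c t by (simp add: s_def power_divide power_mult_distrib power2_eq_square)
    moreover have "sqrt (2 * pi) / c = 1 / sqrt t"
      using t by (simp add: c_def real_sqrt_mult)
    moreover have "of_real (sqrt (2 * pi)) * (of_real (exp (- (s\<^sup>2) / 2)) /\<^sub>R c)
        = complex_of_real (sqrt (2 * pi) / c * exp (- (s\<^sup>2) / 2))"
      by (simp only: scaleR_conv_of_real of_real_mult[symmetric] divide_inverse mult.assoc)
    ultimately show ?thesis
      by (simp only: times_divide_eq_left mult_1_left)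
  qed
  also have "(\<lambda>x. of_real (sqrt (2 * pi)) * h (c * x)) = (\<lambda>y. of_real (exp (- (pi * t * y\<^sup>2))) * cis (- (2 * pi * b * y)))"
  proof
    fix x
    have "(c * x)\<^sup>2 / 2 = pi * t * x\<^sup>2" "s * (c * x) = - (2 * pi * b * x)"
      using c by (simp_all add: s_def power_mult_distrib)
    moreover have "h (c * x) = of_real (1 / sqrt (2 * pi) * exp (- ((c * x)\<^sup>2 / 2))) * cis (s * (c * x))"
      by (simp add: h_def std_normal_density_def scaleR_conv_of_real cis_conv_exp)
    ultimately show "of_real (sqrt (2 * pi)) * h (c * x) = of_real (exp (- (pi * t * x\<^sup>2))) * cis (- (2 * pi * b * x))"
      by simp
  qed
  finally show ?thesis .
qed

lemma summable_on_geometric_int: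
  fixes r :: real
  assumes "0 \<le> r" "r < 1"
  shows "(\<lambda>j::int. r ^ nat \<bar>j\<bar>) summable_on UNIV"
proof -
  have nat: "(\<lambda>n::nat. r ^ n) summable_on UNIV"
    using assms by (intro norm_summable_imp_summable_on) (simp add: summable_geometric norm_power)
  have "(\<lambda>j::int. r ^ nat \<bar>j\<bar>) summable_on (range int)"
    using nat by (subst summable_on_reindex) (auto simp: o_def)
  moreover have "(\<lambda>j::int. r ^ nat \<bar>j\<bar>) summable_on (range (\<lambda>n. - int n))"
    using nat by (subst summable_on_reindex) (auto simp: o_def inj_on_def)
  ultimately have "(\<lambda>j::int. r ^ nat \<bar>j\<bar>) summable_on (range int \<union> range (\<lambda>n. - int n))"
    by (rule summable_on_union)
  also have "range int \<union> range (\<lambda>n. - int n) = UNIV"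
  proof -
    have "j \<in> range int \<union> range (\<lambda>n. - int n)" for j
      by (cases j rule: int_cases2) auto
    then show ?thesis by blast
  qed
  finally show ?thesis .
qed

text \<open>A majorant that is uniform in \<open>x\<close>, as the M-test requires; it comes from completing the
square in \<open>\<bar>j\<bar>\<close>.\<close>

lemma gaussian_le_geometric:
  fixes s x A :: real and j :: int
  assumes "s > 0" "\<bar>x\<bar> \<le> A"
  shows "exp (- (s * (x + of_int j)\<^sup>2)) \<le> exp (s * (1 + 2 * A)\<^sup>2 / 4) * exp (- s) ^ nat \<bar>j\<bar>"
proof -
  let ?u = "\<bar>real_of_int j\<bar>"
  have "\<bar>x * of_int j\<bar> \<le> A * ?u"
    unfolding abs_mult using assms by (intro mult_right_mono) auto
  then have "(x + of_int j)\<^sup>2 \<ge> ?u\<^sup>2 - 2 * A * ?u"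
    using zero_le_power2[of x] abs_le_D2[of "x * of_int j" "A * ?u"]
    unfolding power2_sum power2_abs by linarith
  moreover have "(?u - (1 + 2 * A) / 2)\<^sup>2 \<ge> 0"
    by simp
  then have "?u\<^sup>2 - 2 * A * ?u \<ge> ?u - (1 + 2 * A)\<^sup>2 / 4"
    by (simp add: power2_eq_square field_simps)
  ultimately have "s * (?u - (1 + 2 * A)\<^sup>2 / 4) \<le> s * (x + of_int j)\<^sup>2"
    using assms(1) by (intro mult_left_mono) auto
  moreover have "s * (?u - (1 + 2 * A)\<^sup>2 / 4) = s * ?u - s * (1 + 2 * A)\<^sup>2 / 4"
    by (simp add: right_diff_distrib)
  ultimately have "exp (- (s * (x + of_int j)\<^sup>2)) \<le> exp (s * (1 + 2 * A)\<^sup>2 / 4 + real (nat \<bar>j\<bar>) * - s)"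
    by (simp add: mult.commute)
  then show ?thesis
    by (simp only: exp_add exp_of_nat_mult)
qed

lemma summable_on_gaussian_int:
  fixes s x :: real
  assumes "s > 0"
  shows "(\<lambda>j::int. exp (- (s * (x + of_int j)\<^sup>2))) summable_on UNIV"
proof (rule summable_on_comparison_test)
  show "(\<lambda>j::int. exp (s * (1 + 2 * \<bar>x\<bar>)\<^sup>2 / 4) * exp (- s) ^ nat \<bar>j\<bar>) summable_on UNIV"
    using assms by (intro summable_on_cmult_right summable_on_geometric_int) auto
qed (use gaussian_le_geometric[OF assms order_refl] in auto)

text \<open>Completing the square exhibits the theta series as the sum of a modulated Gaussian over the
integers translated by \<open>- lam * v\<close>. The modulation with frequency \<open>a\<close> translates the
Gaussian on the Fourier side, so that one application of Poisson summation covers the ordinary and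
the alternating series.\<close>

lemma theta_inversion_complex:
  fixes lam v a :: real
  assumes lam: "lam > 0"
  shows "(\<Sum>\<^sub>\<infinity>j::int. of_real (exp (2 * pi * v * j - pi * j\<^sup>2 / lam)) * cis (2 * pi * a * j))
    = of_real (sqrt lam * exp (pi * lam * v\<^sup>2)) *
      (\<Sum>\<^sub>\<infinity>m::int. of_real (exp (- (pi * lam * (m - a)\<^sup>2))) * cis (- (2 * pi * (m - a) * (lam * v))))"
proof -
  define f where "f = (\<lambda>y. of_real (exp (- (pi * (1 / lam) * y\<^sup>2))) * cis (2 * pi * a * y))"
  define c where "c = (\<lambda>m::int. complex_of_real (exp (- (pi * (m - a)\<^sup>2 / (1 / lam))) / sqrt (1 / lam)))"
  have poisson: "(\<Sum>\<^sub>\<infinity>j. f (- (lam * v) + of_int j)) = (\<Sum>\<^sub>\<infinity>m. c m * cis (2 * pi * of_int m * (- (lam * v))))"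
  proof (rule poisson_summation)
    show "continuous_on UNIV f"
      unfolding f_def by (intro continuous_intros)
    show "norm (f (x + of_int j)) \<le> exp (pi / lam * (1 + 2 * 1)\<^sup>2 / 4) * exp (- (pi / lam)) ^ nat \<bar>j\<bar>"
      if "x \<in> {0..1}" for j x
      using gaussian_le_geometric[of "pi / lam" x 1 j] that lam
      by (simp add: f_def norm_mult)
    show "(\<lambda>j::int. exp (pi / lam * (1 + 2 * 1)\<^sup>2 / 4) * exp (- (pi / lam)) ^ nat \<bar>j\<bar>) summable_on UNIV"
      using lam by (intro summable_on_cmult_right summable_on_geometric_int) auto
    show "((\<lambda>y. f y * cis (- (2 * pi * of_int m * y))) has_integral c m) UNIV" for m
    proof -
      have "f y * cis (- (2 * pi * of_int m * y)) = of_real (exp (- (pi * (1 / lam) * y\<^sup>2))) * cis (- (2 * pi * (m - a) * y))" for y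
        unfolding f_def mult.assoc cis_mult by (simp add: algebra_simps)
      then show ?thesis
        using has_integral_gaussian_fourier[of "1 / lam" "m - a"] lam by (simp only: c_def) auto
    qed
    have "(\<lambda>m::int. exp (- (pi * lam * (- a + of_int m)\<^sup>2)) * (1 / sqrt (1 / lam))) summable_on UNIV"
      using lam by (intro summable_on_cmult_left summable_on_gaussian_int) auto
    then show "(\<lambda>m. norm (c m)) summable_on UNIV"
      using lam by (simp add: c_def norm_mult norm_divide real_sqrt_divide mult_ac add.commute)
  qed
  \<comment> \<open>The factor by which completing the square changes each term.\<close>
  define w where "w = of_real (exp (pi * lam * v\<^sup>2)) * cis (2 * pi * a * (lam * v))"
  have lhs: "of_real (exp (2 * pi * v * of_int j - pi * (of_int j)\<^sup>2 / lam)) * cis (2 * pi * a * of_int j) = w * f (- (lam * v) + of_int j)" for j :: int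
  proof -
    have "2 * pi * v * of_int j - pi * (of_int j)\<^sup>2 / lam
        = pi * lam * v\<^sup>2 + - (pi * (1 / lam) * (- (lam * v) + of_int j)\<^sup>2)"
      using lam by (simp add: field_simps power2_eq_square)
    then have 1: "exp (2 * pi * v * of_int j - pi * (of_int j)\<^sup>2 / lam)
        = exp (pi * lam * v\<^sup>2) * exp (- (pi * (1 / lam) * (- (lam * v) + of_int j)\<^sup>2))"
      by (simp only: exp_add)
    have "2 * pi * a * of_int j = 2 * pi * a * (lam * v) + 2 * pi * a * (- (lam * v) + of_int j)"
      by (simp add: algebra_simps)
    then have 2: "cis (2 * pi * a * of_int j) = cis (2 * pi * a * (lam * v)) * cis (2 * pi * a * (- (lam * v) + of_int j))"
      by (simp only: cis_mult)
    show ?thesis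
      unfolding 1 2 w_def f_def of_real_mult by (simp only: mult_ac)
  qed
  have rhs: "w * (c m * cis (2 * pi * of_int m * (- (lam * v))))
    = of_real (sqrt lam * exp (pi * lam * v\<^sup>2)) *
      (of_real (exp (- (pi * lam * (m - a)\<^sup>2))) * cis (- (2 * pi * (m - a) * (lam * v))))" for m
  proof -
    have "- (2 * pi * (m - a) * (lam * v)) = 2 * pi * a * (lam * v) + 2 * pi * of_int m * (- (lam * v))"
      by (simp add: algebra_simps)
    then have 1: "cis (- (2 * pi * (m - a) * (lam * v))) = cis (2 * pi * a * (lam * v)) * cis (2 * pi * of_int m * (- (lam * v)))"
      by (simp only: cis_mult)
    have 2: "c m = of_real (sqrt lam) * of_real (exp (- (pi * lam * (m - a)\<^sup>2)))"
      using lam by (simp add: c_def real_sqrt_divide mult_ac)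
    show ?thesis
      unfolding 1 2 w_def of_real_mult by (simp only: mult_ac)
  qed
  have "(\<Sum>\<^sub>\<infinity>j::int. of_real (exp (2 * pi * v * j - pi * j\<^sup>2 / lam)) * cis (2 * pi * a * j))
      = w * (\<Sum>\<^sub>\<infinity>m. c m * cis (2 * pi * of_int m * (- (lam * v))))"
    by (subst lhs) (subst infsum_cmult_right', subst poisson, rule refl)
  also have "\<dots> = (\<Sum>\<^sub>\<infinity>m. of_real (sqrt lam * exp (pi * lam * v\<^sup>2)) *
      (of_real (exp (- (pi * lam * (of_int m - a)\<^sup>2))) * cis (- (2 * pi * (of_int m - a) * (lam * v)))))"
    by (subst infsum_cmult_right'[symmetric]) (subst rhs, rule refl)
  also have "\<dots> = of_real (sqrt lam * exp (pi * lam * v\<^sup>2)) *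
      (\<Sum>\<^sub>\<infinity>m::int. of_real (exp (- (pi * lam * (m - a)\<^sup>2))) * cis (- (2 * pi * (m - a) * (lam * v))))"
    by (rule infsum_cmult_right')
  finally show ?thesis .
qed

lemma theta_terms_summable:
  fixes lam v :: real
  assumes "lam > 0"
  shows "(\<lambda>j::int. exp (2 * pi * v * j - pi * j\<^sup>2 / lam)) summable_on UNIV"
proof -
  have eq: "exp (2 * pi * v * of_int j - pi * (of_int j)\<^sup>2 / lam)
      = exp (pi * lam * v\<^sup>2) * exp (- (pi / lam * (- (lam * v) + of_int j)\<^sup>2))" for j :: int
  proof -
    have "2 * pi * v * of_int j - pi * (of_int j)\<^sup>2 / lam
        = pi * lam * v\<^sup>2 + - (pi / lam * (- (lam * v) + of_int j)\<^sup>2)"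
      using assms by (simp add: field_simps power2_eq_square)
    then show ?thesis by (simp only: exp_add)
  qed
  have "(\<lambda>j::int. exp (pi * lam * v\<^sup>2) * exp (- (pi / lam * (- (lam * v) + of_int j)\<^sup>2))) summable_on UNIV"
    using assms by (intro summable_on_cmult_right summable_on_gaussian_int) simp
  then show ?thesis by (subst eq)
qed

text \<open>For \<open>a = 0\<close> and \<open>a = 1 / 2\<close> this is
\<open>\<Sum>\<^sub>j (\<plusminus>1)\<^sup>j q^(j\<^sup>2) z\<^sup>j\<close> with \<open>q = exp (- \<pi> / lam)\<close> and
\<open>z = exp (2 \<pi> v)\<close>, a Jacobi theta function in the notation of the main theorem.\<close>

definition theta :: "real \<Rightarrow> real \<Rightarrow> real \<Rightarrow> real" where
  "theta lam a v = (\<Sum>\<^sub>\<infinity>j::int. exp (2 * pi * v * j - pi * j\<^sup>2 / lam) * cos (2 * pi * a * j))"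

theorem theta_inversion:
  fixes lam v a :: real
  assumes lam: "lam > 0"
  shows "theta lam a v = sqrt lam * exp (pi * lam * v\<^sup>2) *
      (\<Sum>\<^sub>\<infinity>m::int. exp (- (pi * lam * (m - a)\<^sup>2)) * cos (2 * pi * (m - a) * (lam * v)))"
proof -
  have Re: "Re (\<Sum>\<^sub>\<infinity>j::int. of_real (g j) * cis (h j)) = (\<Sum>\<^sub>\<infinity>j. g j * cos (h j))"
    if "g summable_on UNIV" "\<And>j. g j \<ge> 0" for g h
  proof -
    have "(\<lambda>j. norm (of_real (g j) * cis (h j))) summable_on UNIV"
      using that by (simp add: norm_mult)
    then have "(\<lambda>j. of_real (g j) * cis (h j)) summable_on UNIV"
      by (rule abs_summable_summable)
    from infsum_Re[OF this] show ?thesis by simp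
  qed
  have "(\<lambda>m::int. exp (- (pi * lam * (m - a)\<^sup>2))) summable_on UNIV"
    using summable_on_gaussian_int[of "pi * lam" "- a"] lam by (simp add: algebra_simps)
  from Re[OF this] have "Re (\<Sum>\<^sub>\<infinity>m::int. of_real (exp (- (pi * lam * (m - a)\<^sup>2))) * cis (- (2 * pi * (m - a) * (lam * v))))
      = (\<Sum>\<^sub>\<infinity>m::int. exp (- (pi * lam * (m - a)\<^sup>2)) * cos (2 * pi * (m - a) * (lam * v)))"
    by simp
  moreover note arg_cong[OF theta_inversion_complex[OF lam, of v a], of Re]
  ultimately show ?thesis
    unfolding theta_def by (simp add: Re[OF theta_terms_summable[OF lam]])
qed

section \<open>The pentagonal number theorem\<close>

text \<open>The quotient \<open>(q;q)\<^sub>n / (q;q)\<^sub>k\<close> written without a division.\<close>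

definition qpoch_tail :: "real \<Rightarrow> nat \<Rightarrow> nat \<Rightarrow> real" where
  "qpoch_tail q n k = (\<Prod>j\<in>{k<..n}. 1 - q ^ j)"

lemma qpoch_tail_0: "qpoch_tail q n 0 = qpochhammer_fin q n"
  unfolding qpoch_tail_def qpochhammer_fin_def by (rule prod.cong) auto

lemma qpoch_tail_self [simp]: "qpoch_tail q n n = 1"
  by (simp add: qpoch_tail_def)

lemma qpoch_tail_Suc_left: "k \<le> n \<Longrightarrow> qpoch_tail q (Suc n) k = (1 - q ^ Suc n) * qpoch_tail q n k"
proof -
  assume "k \<le> n"
  then have "{k<..Suc n} = insert (Suc n) {k<..n}" by auto
  then show ?thesis by (simp add: qpoch_tail_def)
qed

lemma qpoch_tail_Suc_right: "k < n \<Longrightarrow> qpoch_tail q n k = (1 - q ^ Suc k) * qpoch_tail q n (Suc k)"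
proof -
  assume "k < n"
  then have "{k<..n} = insert (Suc k) {Suc k<..n}" by auto
  then show ?thesis by (simp add: qpoch_tail_def)
qed

lemma qpoch_tail_bounds:
  assumes "0 \<le> q" "q \<le> 1"
  shows "0 \<le> qpoch_tail q n k" "qpoch_tail q n k \<le> 1"
  unfolding qpoch_tail_def using assms
  by (auto intro!: prod_nonneg prod_le_1 simp: power_le_one)

text \<open>Shanks' finite form of the pentagonal number theorem, with \<open>q = y\<^sup>2\<close> so that the triangular
numbers \<open>k * (k + 1) / 2\<close> in the exponents need not be halved.\<close>

definition shanks_term :: "real \<Rightarrow> nat \<Rightarrow> nat \<Rightarrow> real" where
  "shanks_term y n k = (- 1) ^ k * qpoch_tail (y\<^sup>2) n k * y ^ (2 * n * k + k * (k + 1))"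

text \<open>Passing from \<open>n\<close> to \<open>n + 1\<close> changes the \<open>k\<close>-th term by the telescoping
difference \<open>V (k - 1) - V k\<close>. What remains are \<open>- V n\<close> and the new last term, and
these are exactly the two new pentagonal powers.\<close>

lemma shanks_identity:
  "(\<Sum>k\<le>n. shanks_term y n k)
    = 1 + (\<Sum>k=1..n. (- 1) ^ k * (y ^ (k * (3 * k + 1)) + y ^ (k * (3 * k - 1))))"
proof (induction n)
  case 0
  then show ?case by (simp add: shanks_term_def)
next
  case (Suc n)
  define V where "V = (\<lambda>k. (- 1) ^ k * qpoch_tail (y\<^sup>2) n k * y ^ (2 * Suc n * (k + 1) + k * (k + 1)))"
  have telescope: "(\<Sum>k\<le>m. shanks_term y (Suc n) k - shanks_term y n k) = - V m" if "m \<le> n" for m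
    using that
  proof (induction m)
    case 0
    have "V 0 = qpoch_tail (y\<^sup>2) n 0 * (y\<^sup>2) ^ Suc n"
      unfolding V_def power_mult[symmetric] by simp
    then show ?case
      by (simp add: shanks_term_def qpoch_tail_Suc_left algebra_simps del: power_Suc)
  next
    case (Suc k)
    define s R E a b where "s = (- 1 :: real) ^ k" and "R = qpoch_tail (y\<^sup>2) n (Suc k)"
      and "E = y ^ (2 * n * Suc k + Suc k * (Suc k + 1))" and "a = y ^ (2 * Suc k)" and "b = y ^ (2 * Suc n)"
    have "2 * Suc n * (k + 1) + k * (k + 1) = 2 * n * Suc k + Suc k * (Suc k + 1)"
      by (simp add: algebra_simps)
    moreover have "qpoch_tail (y\<^sup>2) n k = (1 - a) * R"
      using qpoch_tail_Suc_right[of k n "y\<^sup>2"] Suc.prems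
      unfolding a_def R_def power_mult by simp
    ultimately have 1: "V k = s * ((1 - a) * R) * E"
      by (simp only: V_def s_def E_def)
    have "2 * Suc n * Suc k + Suc k * (Suc k + 1) = (2 * n * Suc k + Suc k * (Suc k + 1)) + 2 * Suc k"
      by (simp add: algebra_simps)
    then have E: "y ^ (2 * Suc n * Suc k + Suc k * (Suc k + 1)) = E * a"
      by (simp only: E_def a_def power_add)
    have 2: "shanks_term y (Suc n) (Suc k) = - s * ((1 - b) * R) * (E * a)"
      unfolding shanks_term_def qpoch_tail_Suc_left[OF Suc.prems] E
      by (simp only: s_def R_def b_def power_mult[of y 2 "Suc n"] power_Suc[of "- 1" k] mult_minus1)
    have 3: "shanks_term y n (Suc k) = - s * R * E"
      unfolding shanks_term_def by (simp add: s_def R_def E_def)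
    have "2 * Suc n * (Suc k + 1) + Suc k * (Suc k + 1) = (2 * Suc n * Suc k + Suc k * (Suc k + 1)) + 2 * Suc n"
      by (simp add: algebra_simps)
    then have "y ^ (2 * Suc n * (Suc k + 1) + Suc k * (Suc k + 1)) = E * a * b"
      by (simp only: b_def power_add[of y _ "2 * Suc n"] E)
    then have 4: "V (Suc k) = - s * R * (E * a * b)"
      by (simp only: V_def s_def R_def) simp
    have "(\<Sum>k\<le>k. shanks_term y (Suc n) k - shanks_term y n k) = - V k"
      using Suc by simp
    then show ?case
      unfolding sum.atMost_Suc 1 2 3 4 by (simp add: algebra_simps)
  qed
  have "(\<Sum>k\<le>Suc n. shanks_term y (Suc n) k)
      = (\<Sum>k\<le>n. shanks_term y n k) + (\<Sum>k\<le>n. shanks_term y (Suc n) k - shanks_term y n k) + shanks_term y (Suc n) (Suc n)"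
    by (simp add: sum_subtractf)
  also have "\<dots> = (\<Sum>k\<le>n. shanks_term y n k) - V n + shanks_term y (Suc n) (Suc n)"
    by (simp add: telescope)
  also have "- V n = (- 1) ^ Suc n * y ^ (Suc n * (3 * Suc n - 1))"
  proof -
    have "2 * Suc n * (n + 1) + n * (n + 1) = Suc n * (3 * Suc n - 1)"
      by (simp add: algebra_simps)
    then show ?thesis
      by (simp only: V_def qpoch_tail_self mult_1_right power_Suc mult_minus1 mult_minus_left)
  qed
  moreover have "shanks_term y (Suc n) (Suc n) = (- 1) ^ Suc n * y ^ (Suc n * (3 * Suc n + 1))"
  proof -
    have "2 * Suc n * Suc n + Suc n * (Suc n + 1) = Suc n * (3 * Suc n + 1)"
      by (simp add: algebra_simps)
    then show ?thesis by (simp only: shanks_term_def qpoch_tail_self)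
  qed
  moreover have "(\<Sum>k=1..Suc n. h k) = (\<Sum>k=1..n. h k) + h (Suc n)" for h :: "nat \<Rightarrow> real"
    by simp
  ultimately show ?case
    by (simp only: Suc.IH distrib_left ac_simps)
qed

text \<open>In Shanks' identity the term \<open>k = 0\<close> is \<open>(q;q)\<^sub>n\<close>, and each of the \<open>n\<close> others is
at most \<open>q\<^sup>n\<close> in absolute value, so they disappear in the limit. The pentagonal exponents are quadratic in
\<open>j\<close>, so the limit is a theta value, at the parameters \<open>2 lam / 3\<close> and
\<open>- 1 / (4 lam)\<close>. This makes the theta inversion available for \<open>(q;q)\<^sub>\<infinity>\<close>
and replaces the transformation law of the Dedekind eta function.\<close>

theorem pentagonal_number_theorem:
  fixes lam :: real
  assumes lam: "lam > 0"
  defines "q \<equiv> exp (- (pi / lam))"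
  shows "qpochhammer_fin q \<longlonglongrightarrow> theta (2 * lam / 3) (1 / 2) (- 1 / (4 * lam))"
proof -
  let ?f = "\<lambda>j::int. exp (2 * pi * (- 1 / (4 * lam)) * j - pi * j\<^sup>2 / (2 * lam / 3)) * cos (2 * pi * (1 / 2) * j)"
  \<comment> \<open>Powers of \<open>y = sqrt q\<close> clear the denominator in the exponents \<open>j * (3 * j + 1) / 2\<close>.\<close>
  define y where "y = exp (- (pi / (2 * lam)))"
  have y: "0 < y" "y < 1" and yq: "y\<^sup>2 = q"
    using lam by (simp_all add: y_def q_def flip: exp_of_nat_mult)
  have ypow: "y ^ m = exp (- (pi * real m / (2 * lam)))" for m
    by (simp add: y_def field_simps flip: exp_of_nat_mult)
  have f_pos: "?f (int k) = (- 1) ^ k * y ^ (k * (3 * k + 1))" for k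
  proof -
    have "cos (2 * pi * (1 / 2) * real_of_int (int k)) = (- 1) ^ k"
      using cos_npi[of k] by (simp add: mult.commute)
    moreover have "2 * pi * (- 1 / (4 * lam)) * real_of_int (int k) - pi * (real_of_int (int k))\<^sup>2 / (2 * lam / 3)
        = - (pi * real (k * (3 * k + 1)) / (2 * lam))"
      using lam by (simp add: field_simps power2_eq_square)
    ultimately show ?thesis by (simp only: ypow mult.commute)
  qed
  have f_neg: "?f (- int k) = (- 1) ^ k * y ^ (k * (3 * k - 1))" for k
  proof -
    have "cos (2 * pi * (1 / 2) * real_of_int (- int k)) = (- 1) ^ k"
      using cos_npi[of k] by (simp add: mult.commute)
    moreover have *: "real (k * (3 * k - 1)) = 3 * (real k)\<^sup>2 - real k"
      by (cases k) (simp_all add: algebra_simps power2_eq_square)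
    have "2 * pi * (- 1 / (4 * lam)) * real_of_int (- int k) - pi * (real_of_int (- int k))\<^sup>2 / (2 * lam / 3)
        = - (pi * real (k * (3 * k - 1)) / (2 * lam))"
      unfolding * using lam by (simp add: field_simps power2_eq_square)
    ultimately show ?thesis by (simp only: ypow mult.commute)
  qed
  have sum_f: "(\<Sum>j=- int n..int n. ?f j) = (\<Sum>k\<le>n. shanks_term y n k)" for n
    unfolding shanks_identity
  proof (induction n)
    case (Suc n)
    have "{- int (Suc n)..int (Suc n)} = insert (int (Suc n)) (insert (- int (Suc n)) {- int n..int n})"
      by auto
    then have "(\<Sum>j=- int (Suc n)..int (Suc n). ?f j) = ?f (int (Suc n)) + (?f (- int (Suc n)) + (\<Sum>j=- int n..int n. ?f j))"
      by (simp del: of_nat_Suc)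
    then show ?case
      unfolding f_pos f_neg Suc.IH by (simp add: algebra_simps)
  qed simp
  have "(\<lambda>j::int. exp (2 * pi * (- 1 / (4 * lam)) * j - pi * j\<^sup>2 / (2 * lam / 3))) summable_on UNIV"
    using lam by (intro theta_terms_summable) simp
  then have "?f summable_on UNIV"
    by (rule abs_summable_summable[OF Infinite_Sum.abs_summable_on_comparison_test'])
      (simp add: abs_mult mult_left_le)
  then have "(?f has_sum infsum ?f UNIV) UNIV" by simp
  then have lim: "(\<lambda>n. \<Sum>j=- int n..int n. ?f j) \<longlonglongrightarrow> infsum ?f UNIV"
    unfolding has_sum_def
    by (rule filterlim_compose[OF _ filterlim_finite_subsets_at_top_int]) auto
  have rest: "(\<lambda>n. \<Sum>k=1..n. shanks_term y n k) \<longlonglongrightarrow> 0"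
  proof (rule Lim_null_comparison)
    have "norm (\<Sum>k=1..n. shanks_term y n k) \<le> real n * q ^ n" for n
    proof -
      have "norm (shanks_term y n k) \<le> q ^ n" if "k \<in> {1..n}" for k
      proof -
        have "2 * n * 1 \<le> 2 * n * k"
          using that by (intro mult_left_mono) auto
        then have "2 * n \<le> 2 * n * k + k * (k + 1)"
          by linarith
        then have "y ^ (2 * n * k + k * (k + 1)) \<le> y ^ (2 * n)"
          using y by (intro power_decreasing) auto
        also have "\<dots> = q ^ n" by (simp add: power_mult yq)
        finally have "qpoch_tail (y\<^sup>2) n k * y ^ (2 * n * k + k * (k + 1)) \<le> 1 * q ^ n"
          using qpoch_tail_bounds[of "y\<^sup>2" n k] y by (intro mult_mono) (auto simp: power_le_one)
        then show ?thesis
          using qpoch_tail_bounds[of "y\<^sup>2" n k] y by (simp add: shanks_term_def abs_mult power_abs power_le_one)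
      qed
      then show ?thesis
        using sum_norm_bound[of "{1..n}" "shanks_term y n" "q ^ n"] by simp
    qed
    then show "\<forall>\<^sub>F n in sequentially. norm (\<Sum>k=1..n. shanks_term y n k) \<le> real n * q ^ n"
      by simp
    have "norm q < 1" using lam by (simp add: q_def)
    then show "(\<lambda>n. real n * q ^ n) \<longlonglongrightarrow> 0"
      using powser_times_n_limit_0[of q] by simp
  qed
  have "qpochhammer_fin q = (\<lambda>n. (\<Sum>j=- int n..int n. ?f j) - (\<Sum>k=1..n. shanks_term y n k))"
  proof
    fix n :: nat
    have "{..n} = insert 0 {1..n}" by auto
    then have "(\<Sum>k\<le>n. shanks_term y n k) = shanks_term y n 0 + (\<Sum>k=1..n. shanks_term y n k)"
      by simp
    then show "qpochhammer_fin q n = (\<Sum>j=- int n..int n. ?f j) - (\<Sum>k=1..n. shanks_term y n k)"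
      unfolding sum_f by (simp add: shanks_term_def qpoch_tail_0 yq)
  qed
  then show ?thesis
    using tendsto_diff[OF lim rest] by (simp only: diff_0_right theta_def)
qed

section \<open>Leading terms for large parameter\<close>

text \<open>An absolute constant: in every tail estimate below, a fixed exponential factor is split off first,
and what is left is dominated by \<open>exp (- \<bar>m\<bar>)\<close>, uniformly for \<open>lam \<ge> 1\<close>.\<close>

definition exp_abs_sum :: real where
  "exp_abs_sum = (\<Sum>\<^sub>\<infinity>m::int. exp (- 1) ^ nat \<bar>m\<bar>)"

lemma infsum_minus_finite_part_le:
  fixes g :: "int \<Rightarrow> real"
  assumes F: "finite F" and B: "B \<ge> 0"
    and g: "\<And>m. m \<notin> F \<Longrightarrow> \<bar>g m\<bar> \<le> B * exp (- real_of_int \<bar>m\<bar>)"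
  shows "\<bar>infsum g UNIV - sum g F\<bar> \<le> B * exp_abs_sum"
proof -
  have e: "exp (- real_of_int \<bar>m\<bar>) = exp (- 1) ^ nat \<bar>m\<bar>" for m
    by (simp flip: exp_of_nat_mult)
  have sum: "(\<lambda>m::int. B * exp (- 1) ^ nat \<bar>m\<bar>) summable_on UNIV"
    by (intro summable_on_cmult_right summable_on_geometric_int) auto
  have sum': "(\<lambda>m::int. B * exp (- 1) ^ nat \<bar>m\<bar>) summable_on A" for A
    by (rule summable_on_subset_banach[OF sum]) simp
  have abs: "(\<lambda>m. norm (g m)) summable_on (- F)"
    by (rule Infinite_Sum.abs_summable_on_comparison_test'[OF sum']) (use g[unfolded e] in auto)
  then have "g summable_on (- F)"
    by (rule abs_summable_summable)
  moreover have "g summable_on F" using F by simp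
  ultimately have "infsum g (F \<union> - F) = infsum g F + infsum g (- F)"
    by (intro infsum_Un_disjoint) auto
  then have "infsum g UNIV - sum g F = infsum g (- F)"
    using F by simp
  also have "norm \<dots> \<le> infsum (\<lambda>m. norm (g m)) (- F)"
    by (rule norm_infsum_bound[OF abs])
  also have "\<dots> \<le> (\<Sum>\<^sub>\<infinity>m\<in>- F. B * exp (- 1) ^ nat \<bar>m\<bar>)"
    by (rule infsum_mono[OF abs sum']) (use g[unfolded e] in auto)
  also have "\<dots> \<le> (\<Sum>\<^sub>\<infinity>m. B * exp (- 1) ^ nat \<bar>m\<bar>)"
    by (rule infsum_mono_neutral[OF sum' sum]) (use B in auto)
  also have "\<dots> = B * exp_abs_sum"
    by (simp add: exp_abs_sum_def infsum_cmult_right')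
  finally show ?thesis by simp
qed

lemma exp_abs_sum_nonneg: "exp_abs_sum \<ge> 0"
  unfolding exp_abs_sum_def by (rule infsum_nonneg) simp

lemma square_int_ge:
  fixes m :: int
  shows "m \<noteq> 0 \<Longrightarrow> real_of_int \<bar>m\<bar> \<le> (real_of_int m)\<^sup>2"
proof -
  assume "m \<noteq> 0"
  then have "\<bar>m\<bar> * 1 \<le> \<bar>m\<bar> * \<bar>m\<bar>" by (intro mult_left_mono) auto
  then have "\<bar>m\<bar> \<le> m\<^sup>2" by (simp add: power2_eq_square)
  then show ?thesis by (metis of_int_le_iff of_int_power)
qed

lemma oblong_int_ge:
  fixes m :: int
  assumes "m \<notin> {0, 1}"
  shows "\<bar>m\<bar> \<le> m * (m - 1)" "2 \<le> m * (m - 1)"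
    and "m \<notin> {-1, 2} \<Longrightarrow> 6 \<le> m * (m - 1)"
proof -
  have "\<bar>m\<bar> * 1 \<le> \<bar>m\<bar> * \<bar>m - 1\<bar>" "m * (m - 1) = \<bar>m\<bar> * \<bar>m - 1\<bar>"
    using assms by (intro mult_left_mono; auto) (auto simp: abs_if algebra_simps)
  then show "\<bar>m\<bar> \<le> m * (m - 1)" by simp
  show "2 \<le> m * (m - 1)"
  proof (cases "m \<ge> 2")
    case True
    then have "2 * 1 \<le> m * (m - 1)" by (intro mult_mono) auto
    then show ?thesis by simp
  next
    case False
    then have "1 * 2 \<le> (- m) * (1 - m)" using assms by (intro mult_mono) auto
    then show ?thesis by (simp add: algebra_simps)
  qed
  show "6 \<le> m * (m - 1)" if "m \<notin> {-1, 2}"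
  proof (cases "m \<ge> 3")
    case True
    then have "3 * 2 \<le> m * (m - 1)" by (intro mult_mono) auto
    then show ?thesis by simp
  next
    case False
    then have "2 * 3 \<le> (- m) * (1 - m)" using assms that by (intro mult_mono) auto
    then show ?thesis by (simp add: algebra_simps)
  qed
qed

lemma theta_asymptotics:
  fixes lam x :: real
  assumes lam: "lam \<ge> 1"
  shows "\<bar>(\<Sum>\<^sub>\<infinity>m::int. exp (- (pi * lam * m\<^sup>2)) * cos (2 * pi * m * x)) - 1\<bar>
    \<le> exp (1 - pi * lam) * exp_abs_sum"
proof -
  let ?g = "\<lambda>m::int. exp (- (pi * lam * m\<^sup>2)) * cos (2 * pi * m * x)"
  have "\<bar>infsum ?g UNIV - sum ?g {0}\<bar> \<le> exp (1 - pi * lam) * exp_abs_sum"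
  proof (rule infsum_minus_finite_part_le)
    fix m :: int assume "m \<notin> {0}"
    then have m: "real_of_int \<bar>m\<bar> \<le> (real_of_int m)\<^sup>2" "1 \<le> real_of_int \<bar>m\<bar>"
      using square_int_ge by auto
    have "1 \<le> pi * lam" using lam pi_gt3 by (simp add: mult_le_cancel_right1 mult_ge1_I)
    \<comment> \<open>The factor \<open>exp (- \<pi> lam)\<close> is reserved; the rest of the exponent only has to beat \<open>1 - \<bar>m\<bar>\<close>.\<close>
    then have "1 * ((real_of_int m)\<^sup>2 - 1) \<le> (pi * lam) * ((real_of_int m)\<^sup>2 - 1)"
      using m by (intro mult_right_mono) auto
    then have "- (pi * lam * (real_of_int m)\<^sup>2) \<le> (1 - pi * lam) + - real_of_int \<bar>m\<bar>"
      using m by (simp add: algebra_simps)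
    then have "exp (- (pi * lam * m\<^sup>2)) \<le> exp (1 - pi * lam) * exp (- real_of_int \<bar>m\<bar>)"
      by (simp flip: exp_add)
    then show "\<bar>?g m\<bar> \<le> exp (1 - pi * lam) * exp (- real_of_int \<bar>m\<bar>)"
      by (rule order_trans[rotated]) (simp add: abs_mult mult_left_le)
  qed auto
  then show ?thesis by simp
qed

lemma alternating_theta_asymptotics:
  fixes lam x :: real
  assumes lam: "lam \<ge> 1"
  shows "\<bar>(\<Sum>\<^sub>\<infinity>m::int. exp (- (pi * lam * (m - 1 / 2)\<^sup>2)) * cos (2 * pi * (m - 1 / 2) * x))
      - 2 * exp (- (pi * lam / 4)) * cos (pi * x)\<bar>
    \<le> exp (- (pi * lam / 4)) * exp (2 - 2 * pi * lam) * exp_abs_sum"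
proof -
  let ?g = "\<lambda>m::int. exp (- (pi * lam * (m - 1 / 2)\<^sup>2)) * cos (2 * pi * (m - 1 / 2) * x)"
  have "\<bar>infsum ?g UNIV - sum ?g {0, 1}\<bar> \<le> (exp (- (pi * lam / 4)) * exp (2 - 2 * pi * lam)) * exp_abs_sum"
  proof (rule infsum_minus_finite_part_le)
    fix m :: int assume m: "m \<notin> {0, 1}"
    define p where "p = real_of_int (m * (m - 1))"
    have p: "real_of_int \<bar>m\<bar> \<le> p" "2 \<le> p" "(m - 1 / 2)\<^sup>2 = p + 1 / 4"
      using oblong_int_ge(1,2)[OF m] unfolding p_def
      by (simp only: of_int_le_iff, metis of_int_le_iff of_int_numeral, simp add: power2_eq_square algebra_simps)
    have "1 \<le> pi * lam" using lam pi_gt3 by (simp add: mult_le_cancel_right1 mult_ge1_I)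
    then have "1 * (p - 2) \<le> (pi * lam) * (p - 2)"
      using p by (intro mult_right_mono) auto
    then have "- (pi * lam * (m - 1 / 2)\<^sup>2) \<le> - (pi * lam / 4) + (2 - 2 * pi * lam) + - real_of_int \<bar>m\<bar>"
      using p(1) unfolding p(3) by (simp add: algebra_simps)
    then have "exp (- (pi * lam * (m - 1 / 2)\<^sup>2)) \<le> exp (- (pi * lam / 4)) * exp (2 - 2 * pi * lam) * exp (- real_of_int \<bar>m\<bar>)"
      by (simp flip: exp_add)
    then show "\<bar>?g m\<bar> \<le> exp (- (pi * lam / 4)) * exp (2 - 2 * pi * lam) * exp (- real_of_int \<bar>m\<bar>)"
      by (rule order_trans[rotated]) (simp add: abs_mult mult_left_le)
  qed auto
  moreover have "sum ?g {0, 1} = 2 * exp (- (pi * lam / 4)) * cos (pi * x)"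
    by (simp add: power2_eq_square)
  ultimately show ?thesis by simp
qed

text \<open>The terms \<open>m = -1\<close> and \<open>m = 2\<close> would be of relative size
\<open>exp (- (4 / 3) \<pi> lam)\<close>, too large for the precision \<open>exp (- 2 \<pi> lam)\<close> needed in the
alternating case, but their cosine factor \<open>cos (\<pi> / 2)\<close> is zero.\<close>

lemma pentagonal_theta_asymptotics:
  fixes lam :: real
  assumes lam: "lam \<ge> 1"
  shows "\<bar>(\<Sum>\<^sub>\<infinity>m::int. exp (- (pi * (2 * lam / 3) * (m - 1 / 2)\<^sup>2)) * cos (2 * pi * (m - 1 / 2) * (- 1 / 6)))
      - sqrt 3 * exp (- (pi * lam / 6))\<bar>
    \<le> exp (- (pi * lam / 6)) * exp (3 - 2 * pi * lam) * exp_abs_sum"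
proof -
  let ?g = "\<lambda>m::int. exp (- (pi * (2 * lam / 3) * (m - 1 / 2)\<^sup>2)) * cos (2 * pi * (m - 1 / 2) * (- 1 / 6))"
  have "\<bar>infsum ?g UNIV - sum ?g {- 1, 0, 1, 2}\<bar> \<le> (exp (- (pi * lam / 6)) * exp (3 - 2 * pi * lam)) * exp_abs_sum"
  proof (rule infsum_minus_finite_part_le)
    fix m :: int assume m': "m \<notin> {- 1, 0, 1, 2}"
    then have m: "m \<notin> {0, 1}" "m \<notin> {-1, 2}" by auto
    define p where "p = real_of_int (m * (m - 1))"
    have p: "real_of_int \<bar>m\<bar> \<le> p" "6 \<le> p" "(m - 1 / 2)\<^sup>2 = p + 1 / 4"
      using oblong_int_ge(1)[OF m(1)] oblong_int_ge(3)[OF m] unfolding p_def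
      by (simp only: of_int_le_iff, metis of_int_le_iff of_int_numeral, simp add: power2_eq_square algebra_simps)
    have "3 * 1 \<le> pi * lam" using lam pi_gt3 by (intro mult_mono) auto
    then have "1 * (p - 3) \<le> (pi * (2 * lam / 3)) * (p - 3)"
      using p by (intro mult_right_mono) auto
    then have "- (pi * (2 * lam / 3) * (m - 1 / 2)\<^sup>2) \<le> - (pi * lam / 6) + (3 - 2 * pi * lam) + - real_of_int \<bar>m\<bar>"
      using p(1) unfolding p(3) by (simp add: field_simps)
    then have "exp (- (pi * (2 * lam / 3) * (m - 1 / 2)\<^sup>2)) \<le> exp (- (pi * lam / 6)) * exp (3 - 2 * pi * lam) * exp (- real_of_int \<bar>m\<bar>)"
      by (simp flip: exp_add)
    then show "\<bar>?g m\<bar> \<le> exp (- (pi * lam / 6)) * exp (3 - 2 * pi * lam) * exp (- real_of_int \<bar>m\<bar>)"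
      by (rule order_trans[rotated]) (simp add: abs_mult mult_left_le)
  qed auto
  moreover have "sum ?g {- 1, 0, 1, 2} = sqrt 3 * exp (- (pi * lam / 6))"
  proof -
    have "?g 0 = exp (- (pi * lam / 6)) * (sqrt 3 / 2)" "?g 1 = exp (- (pi * lam / 6)) * (sqrt 3 / 2)"
      using cos_30 by (simp_all add: power2_eq_square)
    moreover have "?g (- 1) = 0" "?g 2 = 0"
      using cos_pi_half by simp_all
    moreover have "sum h {- 1, 0, 1, 2} = h (- 1) + h 0 + (h 1 + h 2)" for h :: "int \<Rightarrow> real"
      by simp
    ultimately show ?thesis
      by (simp only: add_0_left add_0_right) simp
  qed
  ultimately show ?thesis by simp
qed

lemma theta_0_estimate:
  assumes lam: "lam \<ge> 1"
  obtains \<alpha> where "theta lam 0 v = sqrt lam * exp (pi * lam * v\<^sup>2) * (1 + \<alpha>)"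
    and "\<bar>\<alpha>\<bar> \<le> exp (1 - pi * lam) * exp_abs_sum"
proof
  let ?s = "\<Sum>\<^sub>\<infinity>m::int. exp (- (pi * lam * m\<^sup>2)) * cos (2 * pi * m * (lam * v))"
  show "theta lam 0 v = sqrt lam * exp (pi * lam * v\<^sup>2) * (1 + (?s - 1))"
    using theta_inversion[of lam 0 v] lam by simp
  show "\<bar>?s - 1\<bar> \<le> exp (1 - pi * lam) * exp_abs_sum"
    by (rule theta_asymptotics[OF lam])
qed

lemma theta_half_estimate:
  assumes lam: "lam \<ge> 1"
  obtains \<alpha> where "theta lam (1 / 2) v
      = 2 * sqrt lam * exp (pi * lam * v\<^sup>2 - pi * lam / 4) * (cos (pi * lam * v) + \<alpha>)"
    and "\<bar>\<alpha>\<bar> \<le> exp (2 - 2 * pi * lam) * exp_abs_sum"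
proof
  let ?s = "\<Sum>\<^sub>\<infinity>m::int. exp (- (pi * lam * (m - 1 / 2)\<^sup>2)) * cos (2 * pi * (m - 1 / 2) * (lam * v))"
  let ?e = "exp (- (pi * lam / 4))"
  have "exp (pi * lam * v\<^sup>2 - pi * lam / 4) = exp (pi * lam * v\<^sup>2) * ?e"
    by (simp flip: exp_add)
  moreover have "theta lam (1 / 2) v = sqrt lam * exp (pi * lam * v\<^sup>2) * ?s"
    using theta_inversion[of lam "1 / 2" v] lam by (simp only:)
  moreover have "x * y * s = 2 * x * (y * ?e) * (C + (s / (2 * ?e) - C))" for x y s C :: real
    by simp
  ultimately show "theta lam (1 / 2) v
      = 2 * sqrt lam * exp (pi * lam * v\<^sup>2 - pi * lam / 4) * (cos (pi * lam * v) + (?s / (2 * ?e) - cos (pi * lam * v)))"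
    by (simp only:)
  have "\<bar>?s / (2 * ?e) - cos (pi * lam * v)\<bar> = \<bar>?s - 2 * ?e * cos (pi * (lam * v))\<bar> / (2 * ?e)"
  proof -
    have "\<bar>s / (2 * e) - C\<bar> = \<bar>s - 2 * e * C\<bar> / (2 * e)" if "e > 0" for s e C :: real
    proof -
      have "s / (2 * e) - C = (s - 2 * e * C) / (2 * e)"
        using that by (simp add: field_simps)
      then show ?thesis using that by (simp only: abs_divide)
    qed
    then show ?thesis by (simp only: mult.assoc[of pi lam v] exp_gt_zero)
  qed
  also have "\<dots> \<le> (?e * exp (2 - 2 * pi * lam) * exp_abs_sum) / (2 * ?e)"
    by (intro divide_right_mono alternating_theta_asymptotics lam) simp
  also have "\<dots> \<le> exp (2 - 2 * pi * lam) * exp_abs_sum"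
    using exp_abs_sum_nonneg by (simp add: divide_le_eq)
  finally show "\<bar>?s / (2 * ?e) - cos (pi * lam * v)\<bar> \<le> exp (2 - 2 * pi * lam) * exp_abs_sum" .
qed

lemma euler_function_asymptotics:
  assumes lam: "lam \<ge> 1"
  obtains \<beta> where "qpochhammer_fin (exp (- (pi / lam)))
      \<longlonglongrightarrow> sqrt (2 * lam) * exp (pi / (24 * lam) - pi * lam / 6) * (1 + \<beta>)"
    and "\<bar>\<beta>\<bar> \<le> exp (3 - 2 * pi * lam) * exp_abs_sum"
proof
  let ?s = "\<Sum>\<^sub>\<infinity>m::int. exp (- (pi * (2 * lam / 3) * (m - 1 / 2)\<^sup>2)) * cos (2 * pi * (m - 1 / 2) * (- 1 / 6))"
  let ?e = "exp (- (pi * lam / 6))"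
  define \<beta> where "\<beta> = (?s - sqrt 3 * ?e) / (sqrt 3 * ?e)"
  have s: "?s = sqrt 3 * ?e * (1 + \<beta>)"
    unfolding \<beta>_def by (simp add: field_simps)
  have "(2 * lam / 3) * (- 1 / (4 * lam)) = - 1 / 6" "pi * (2 * lam / 3) * (- 1 / (4 * lam))\<^sup>2 = pi / (24 * lam)"
    using lam by (simp_all add: field_simps power2_eq_square)
  then have "theta (2 * lam / 3) (1 / 2) (- 1 / (4 * lam))
      = sqrt (2 * lam / 3) * exp (pi / (24 * lam)) * ?s"
    using theta_inversion[of "2 * lam / 3" "1 / 2" "- 1 / (4 * lam)"] lam by (simp only:)
  also have "\<dots> = (sqrt (2 * lam / 3) * sqrt 3) * (exp (pi / (24 * lam)) * ?e) * (1 + \<beta>)"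
    unfolding s by (simp only: mult_ac)
  also have "sqrt (2 * lam / 3) * sqrt 3 = sqrt (2 * lam)"
    by (simp flip: real_sqrt_mult)
  also have "exp (pi / (24 * lam)) * ?e = exp (pi / (24 * lam) - pi * lam / 6)"
    by (simp flip: exp_add)
  finally show "qpochhammer_fin (exp (- (pi / lam)))
      \<longlonglongrightarrow> sqrt (2 * lam) * exp (pi / (24 * lam) - pi * lam / 6) * (1 + \<beta>)"
    using pentagonal_number_theorem[of lam] lam by simp
  have "\<bar>\<beta>\<bar> = \<bar>?s - sqrt 3 * ?e\<bar> / (sqrt 3 * ?e)"
    by (simp add: \<beta>_def abs_divide abs_mult)
  also have "\<dots> \<le> (?e * exp (3 - 2 * pi * lam) * exp_abs_sum) / (sqrt 3 * ?e)"
    by (intro divide_right_mono pentagonal_theta_asymptotics lam) simp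
  also have "\<dots> \<le> (?e * exp (3 - 2 * pi * lam) * exp_abs_sum) / (1 * ?e)"
    using exp_abs_sum_nonneg by (intro divide_left_mono mult_right_mono) auto
  also have "\<dots> = exp (3 - 2 * pi * lam) * exp_abs_sum"
    by simp
  finally show "\<bar>\<beta>\<bar> \<le> exp (3 - 2 * pi * lam) * exp_abs_sum" .
qed

section \<open>Ramanujan's function as a perturbed theta series\<close>

lemma qpochhammer_fin_pos:
  assumes "0 < q" "q < 1"
  shows "qpochhammer_fin q k > 0"
  unfolding qpochhammer_fin_def using assms
  by (intro prod_pos) (auto simp: power_less_one_iff)

text \<open>The lower bound is the Weierstrass product inequality \<open>\<Prod> (1 - x\<^sub>j) \<ge> 1 - \<Sum> x\<^sub>j\<close>
for the remaining factors, summed as a geometric series.\<close>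

lemma qpochhammer_limit_bounds:
  assumes q: "0 < q" "q < 1" and lim: "qpochhammer_fin q \<longlonglongrightarrow> P"
  shows "P \<le> qpochhammer_fin q k"
    and "qpochhammer_fin q k * (1 - q ^ (k + 1) / (1 - q)) \<le> P"
proof -
  have split: "qpochhammer_fin q (k + i) = qpochhammer_fin q k * (\<Prod>j<i. 1 - q ^ (k + 1 + j))" for i
    by (induction i) (simp_all add: qpochhammer_fin_def mult_ac)
  have lim': "(\<lambda>i. qpochhammer_fin q (k + i)) \<longlonglongrightarrow> P"
    using LIMSEQ_ignore_initial_segment[OF lim, of k] by (simp add: add.commute)
  have fac: "q ^ (k + 1 + j) \<in> {0..1}" for j
    using q power_le_one[of q "k + 1 + j"] by simp
  have "qpochhammer_fin q (k + i) \<le> qpochhammer_fin q k" for i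
    unfolding split using fac less_imp_le[OF qpochhammer_fin_pos[OF q]]
    by (intro mult_left_le prod_le_1) auto
  then show "P \<le> qpochhammer_fin q k"
    by (intro LIMSEQ_le_const2[OF lim']) auto
  have "qpochhammer_fin q k * (1 - q ^ (k + 1) / (1 - q)) \<le> qpochhammer_fin q (k + i)" for i
  proof -
    have "(\<Sum>j<i. q ^ (k + 1 + j)) = q ^ (k + 1) * (\<Sum>j<i. q ^ j)"
      by (simp add: power_add sum_distrib_left mult.assoc)
    also have "\<dots> = q ^ (k + 1) * ((1 - q ^ i) / (1 - q))"
      using q by (simp add: sum_gp_strict)
    also have "\<dots> \<le> q ^ (k + 1) * (1 / (1 - q))"
      using q by (intro mult_left_mono divide_right_mono) auto
    finally have "1 - q ^ (k + 1) / (1 - q) \<le> 1 - (\<Sum>j<i. q ^ (k + 1 + j))"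
      by simp
    also have "\<dots> \<le> (\<Prod>j<i. 1 - q ^ (k + 1 + j))"
      by (rule Weierstrass_prod_ineq) (rule fac)
    finally show ?thesis
      unfolding split using qpochhammer_fin_pos[OF q] by (intro mult_left_mono) (auto intro: less_imp_le)
  qed
  then show "qpochhammer_fin q k * (1 - q ^ (k + 1) / (1 - q)) \<le> P"
    by (intro LIMSEQ_le_const[OF lim']) auto
qed

text \<open>The factor by which the term at \<open>j = k - 2 n\<close> of the normalized series for Ramanujan's
function differs from the corresponding term of the theta series. The value 0 to the left of
\<open>- 2 n\<close> accounts for the absence of terms with \<open>k < 0\<close>.\<close>

definition shifted_ratio :: "real \<Rightarrow> real \<Rightarrow> nat \<Rightarrow> int \<Rightarrow> real" where
  "shifted_ratio q P n j = (if j \<ge> - 2 * int n then P / qpochhammer_fin q (nat (2 * int n + j)) else 0)"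

text \<open>The bound holds for every integer \<open>j\<close>: to the left of \<open>- 2 n\<close>, where the difference
equals 1, the right hand side exceeds 1. Being of the form \<open>q^(2 n + j) / (1 - q)\<close>, it can be
absorbed into the theta series, where the factor \<open>q\<^sup>j\<close> merely shifts \<open>v\<close>. Hence
the sum needs no splitting into a central part and tails.\<close>

lemma shifted_ratio_near_1:
  assumes lam: "lam > 0" and q_def: "q = exp (- (pi / lam))" and lim: "qpochhammer_fin q \<longlonglongrightarrow> P"
  shows "\<bar>shifted_ratio q P n j - 1\<bar> \<le> exp (- (pi / lam) * (2 * real n + j)) / (1 - q)"
proof -
  have q: "0 < q" "q < 1"
    using lam by (simp_all add: q_def)
  show ?thesis
  proof (cases "j \<ge> - 2 * int n")
    case True
    define k where "k = nat (2 * int n + j)"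
    have k: "real k = 2 * real n + j"
      using True by (simp add: k_def)
    note b = qpochhammer_limit_bounds[OF q lim, of k] and pos = qpochhammer_fin_pos[OF q, of k]
    have "P / qpochhammer_fin q k \<le> 1" "1 - q ^ (k + 1) / (1 - q) \<le> P / qpochhammer_fin q k"
      using b pos by (simp_all add: divide_le_eq le_divide_eq mult.commute)
    then have "\<bar>P / qpochhammer_fin q k - 1\<bar> \<le> q ^ (k + 1) / (1 - q)"
      by simp
    also have "\<dots> \<le> q ^ k / (1 - q)"
      using q by (intro divide_right_mono power_decreasing) auto
    also have "q ^ k = exp (- (pi / lam) * (2 * real n + j))"
      unfolding q_def k[symmetric] by (simp add: mult.commute flip: exp_of_nat_mult)
    finally show ?thesis
      using True by (simp add: shifted_ratio_def k_def)
  next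
    case False
    then have "2 * real n + j \<le> 0"
      by linarith
    then have "0 \<le> - (pi / lam) * (2 * real n + j)"
      using lam by (simp add: mult_nonneg_nonpos divide_nonpos_pos)
    then have "1 / 1 \<le> exp (- (pi / lam) * (2 * real n + j)) / (1 - q)"
      using q by (intro frac_le) auto
    then show ?thesis
      using False by (simp add: shifted_ratio_def)
  qed
qed

text \<open>With \<open>k = 2 n + j\<close>, the exponent \<open>k\<^sup>2 - 4 n k\<close> equals \<open>j\<^sup>2 - 4 n\<^sup>2\<close>, so
the series is centred at \<open>k = 2 n\<close>; the shift is even and leaves the signs unchanged. The
factor \<open>cos (2 \<pi> a)\<close> is the sign \<open>\<plusminus>1\<close> that selects one of the two
arguments in the main theorem.\<close>

lemma ramanujan_series_eq_theta:
  fixes v :: real and n :: nat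
  assumes lam: "lam > 0" and a: "a \<in> {0, 1 / 2}" and q_def: "q = exp (- (pi / lam))"
    and lim: "qpochhammer_fin q \<longlonglongrightarrow> P"
  defines "R \<equiv> \<Sum>k. q ^ (k\<^sup>2) * (cos (2 * pi * a) * (q powi (- 4 * int n) * exp (2 * pi * v))) ^ k / qpochhammer_fin q k"
  obtains d where "P * R = exp (4 * pi * (real n)\<^sup>2 / lam + 4 * pi * real n * v) * (theta lam a v + d)"
    and "\<bar>d\<bar> \<le> exp (- (2 * pi * real n / lam)) / (1 - q) * theta lam 0 (v - 1 / (2 * lam))"
proof -
  have q: "0 < q" "q < 1"
    using lam by (simp_all add: q_def)
  let ?r = "shifted_ratio q P n"
  define Q where "Q = exp (4 * pi * (real n)\<^sup>2 / lam + 4 * pi * real n * v)"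
  define c where "c = (\<lambda>j::int. exp (2 * pi * v * j - pi * j\<^sup>2 / lam))"
  define f where "f = (\<lambda>j::int. c j * cos (2 * pi * a * j))"
  define h where "h = (\<lambda>j::int. exp (2 * pi * (v - 1 / (2 * lam)) * j - pi * j\<^sup>2 / lam))"
  define K where "K = exp (- (2 * pi * real n / lam)) / (1 - q)"
  have sum_c: "c summable_on UNIV" and sum_h: "h summable_on UNIV"
    unfolding c_def h_def by (intro theta_terms_summable lam)+
  have c_pos: "c j > 0" for j by (simp add: c_def)
  have sum_f: "f summable_on UNIV"
    by (rule abs_summable_summable[OF Infinite_Sum.abs_summable_on_comparison_test'[OF sum_c]])
      (simp add: f_def abs_mult c_pos less_imp_le mult_left_le)
  have bound: "\<bar>f j * (?r j - 1)\<bar> \<le> K * h j" for j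
  proof -
    have "\<bar>f j\<bar> * \<bar>?r j - 1\<bar> \<le> c j * (exp (- (pi / lam) * (2 * real n + j)) / (1 - q))"
      using shifted_ratio_near_1[OF lam q_def lim, of n j] c_pos[of j]
      by (intro mult_mono) (auto simp: f_def abs_mult mult_left_le)
    also have "\<dots> = K * h j"
    proof -
      have "(2 * pi * v * j - pi * (of_int j)\<^sup>2 / lam) + (- (pi / lam) * (2 * real n + j))
          = - (2 * pi * real n / lam) + (2 * pi * (v - 1 / (2 * lam)) * j - pi * (of_int j)\<^sup>2 / lam)"
        using lam by (simp add: field_simps)
      then have "c j * exp (- (pi / lam) * (2 * real n + j)) = exp (- (2 * pi * real n / lam)) * h j"
        unfolding c_def h_def by (simp only: exp_add[symmetric])
      then show ?thesis by (simp add: K_def)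
    qed
    finally show ?thesis by (simp add: abs_mult)
  qed
  have sum_Kh: "(\<lambda>j. K * h j) summable_on UNIV"
    by (intro summable_on_cmult_right sum_h)
  have abs_d: "(\<lambda>j. norm (f j * (?r j - 1))) summable_on UNIV"
    by (rule Infinite_Sum.abs_summable_on_comparison_test'[OF sum_Kh]) (simp add: bound)
  then have sum_d: "(\<lambda>j. f j * (?r j - 1)) summable_on UNIV"
    by (rule abs_summable_summable)
  define d where "d = (\<Sum>\<^sub>\<infinity>j. f j * (?r j - 1))"
  have "\<bar>d\<bar> \<le> (\<Sum>\<^sub>\<infinity>j. norm (f j * (?r j - 1)))"
    unfolding d_def using norm_infsum_bound[OF abs_d] by simp
  also have "\<dots> \<le> (\<Sum>\<^sub>\<infinity>j. K * h j)"
    by (rule infsum_mono[OF abs_d sum_Kh]) (simp add: bound)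
  also have "\<dots> = K * theta lam 0 (v - 1 / (2 * lam))"
    by (simp add: infsum_cmult_right' theta_def h_def)
  finally have d: "\<bar>d\<bar> \<le> K * theta lam 0 (v - 1 / (2 * lam))" .

  have "((\<lambda>j. f j + f j * (?r j - 1)) has_sum (theta lam a v + d)) UNIV"
    unfolding theta_def d_def using sum_f sum_d
    by (intro has_sum_add) (auto simp: f_def c_def)
  then have "((\<lambda>j. f j * ?r j) has_sum (theta lam a v + d)) UNIV"
    by (simp add: algebra_simps)
  also have "?this \<longleftrightarrow> ((\<lambda>j. f j * ?r j) has_sum (theta lam a v + d)) (range (\<lambda>k. int k - 2 * int n))"
  proof (rule has_sum_cong_neutral)
    fix j assume j: "j \<in> UNIV - range (\<lambda>k. int k - 2 * int n)"
    have "j < - 2 * int n"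
    proof (rule ccontr)
      assume "\<not> j < - 2 * int n"
      then have "j = int (nat (j + 2 * int n)) - 2 * int n" by simp
      then show False using j by blast
    qed
    then show "f j * ?r j = 0" by (simp add: shifted_ratio_def)
  qed auto
  also have "\<dots> \<longleftrightarrow> ((\<lambda>k. f (int k - 2 * int n) * ?r (int k - 2 * int n)) has_sum (theta lam a v + d)) UNIV"
    by (subst has_sum_reindex) (auto simp: inj_on_def o_def)
  finally have "(\<lambda>k. f (int k - 2 * int n) * ?r (int k - 2 * int n)) sums (theta lam a v + d)"
    by (rule has_sum_imp_sums)
  then have sums: "(\<lambda>k. Q * (f (int k - 2 * int n) * ?r (int k - 2 * int n))) sums (Q * (theta lam a v + d))"
    by (rule sums_mult)
  have term_eq: "Q * (f (int k - 2 * int n) * ?r (int k - 2 * int n))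
      = P * (q ^ (k\<^sup>2) * (cos (2 * pi * a) * (q powi (- 4 * int n) * exp (2 * pi * v))) ^ k / qpochhammer_fin q k)" for k
  proof -
    have r: "?r (int k - 2 * int n) = P / qpochhammer_fin q k"
      by (simp add: shifted_ratio_def)
    have sign: "cos (2 * pi * a * real_of_int (int k - 2 * int n)) = cos (2 * pi * a) ^ k"
    proof (cases "a = 0")
      case False
      then have a: "a = 1 / 2" using a by simp
      have "2 * pi * a * real_of_int (int k - 2 * int n) = pi * real k - 2 * pi * real n"
        by (simp add: a algebra_simps)
      also have "cos \<dots> = (- 1) ^ k"
      proof -
        have "cos (2 * pi * real n) = 1" "sin (2 * pi * real n) = 0"
          using cos_2npi[of n] sin_2npi[of n] by (simp_all only: mult_ac)
        then show ?thesis
          using cos_npi[of k] by (simp only: cos_diff mult.commute[of pi])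
      qed
      finally show ?thesis by (simp add: a)
    qed simp
    have "q powi (- 4 * int n) = exp (4 * pi * real n / lam)"
      unfolding q_def exp_power_int by simp
    then have "q ^ (k\<^sup>2) * (q powi (- 4 * int n) * exp (2 * pi * v)) ^ k
        = exp (real (k\<^sup>2) * (- (pi / lam)) + real k * (4 * pi * real n / lam + 2 * pi * v))"
      by (simp only: exp_add exp_of_nat_mult q_def power_mult_distrib distrib_left)
    moreover have "real (k\<^sup>2) * (- (pi / lam)) + real k * (4 * pi * real n / lam + 2 * pi * v)
        = (4 * pi * (real n)\<^sup>2 / lam + 4 * pi * real n * v)
          + (2 * pi * v * real_of_int (int k - 2 * int n) - pi * (real_of_int (int k - 2 * int n))\<^sup>2 / lam)"
      using lam by (simp add: field_simps power2_eq_square)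
    ultimately have "q ^ (k\<^sup>2) * (q powi (- 4 * int n) * exp (2 * pi * v)) ^ k = Q * c (int k - 2 * int n)"
      by (simp only: Q_def c_def exp_add)
    then show ?thesis
      unfolding r f_def sign power_mult_distrib[of "cos (2 * pi * a)"] by (simp add: mult_ac)
  qed
  have "P * R = Q * (theta lam a v + d)"
  proof -
    let ?a = "\<lambda>k. q ^ (k\<^sup>2) * (cos (2 * pi * a) * (q powi (- 4 * int n) * exp (2 * pi * v))) ^ k / qpochhammer_fin q k"
    have eq: "Q * (theta lam a v + d) = (\<Sum>k. P * ?a k)"
      using sums_unique[OF sums] by (simp only: term_eq)
    have "P = 0 \<or> summable ?a"
      using sums_summable[OF sums] by (simp only: term_eq summable_cmult_iff)
    then show ?thesis
    proof
      assume "P = 0"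
      then show ?thesis using eq by simp
    next
      assume "summable ?a"
      then show ?thesis unfolding eq R_def by (rule suminf_mult[symmetric])
    qed
  qed
  then show ?thesis
    using that d by (simp only: Q_def K_def)
qed

lemma ramanujan_entire_of_real:
  assumes "0 < q" "q < 1"
  shows "ramanujan_entire q (complex_of_real (- w)) = of_real (\<Sum>k. q ^ (k\<^sup>2) * w ^ k / qpochhammer_fin q k)"
proof -
  have eq: "of_real q ^ (k\<^sup>2) * (- complex_of_real (- w)) ^ k / of_real (qpochhammer_fin q k)
      = of_real (q ^ (k\<^sup>2) * w ^ k / qpochhammer_fin q k)" for k
    by simp
  have "summable (\<lambda>k. complex_of_real (q ^ (k\<^sup>2) * w ^ k / qpochhammer_fin q k))"
    using summable_ramanujan_entire[OF assms, of "complex_of_real (- w)"] unfolding eq .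
  then have "summable (\<lambda>k. q ^ (k\<^sup>2) * w ^ k / qpochhammer_fin q k)"
    by (simp only: summable_complex_of_real)
  then show ?thesis
    unfolding ramanujan_entire_eq[OF assms] eq by (rule suminf_of_real[symmetric])
qed

text \<open>Since \<open>q^(2 n) = exp (- 2 \<pi> n / lam)\<close>, the condition on \<open>n\<close> makes this factor at
most \<open>exp (- 4 \<pi> lam)\<close>; one factor \<open>exp (\<pi> lam)\<close> pays for \<open>1 / (1 - q)\<close>. The
shift of \<open>v\<close> by \<open>1 / (2 lam)\<close> changes the Gaussian prefactor only by a factor that is
bounded for bounded \<open>v\<close>.\<close>

lemma perturbation_bound:
  fixes lam v V :: real and n :: nat
  assumes lam: "lam \<ge> 1" and n: "2 * lam\<^sup>2 \<le> real n" and v: "\<bar>v\<bar> \<le> V"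
    and q_def: "q = exp (- (pi / lam))"
  shows "exp (- (2 * pi * real n / lam)) / (1 - q) * theta lam 0 (v - 1 / (2 * lam))
    \<le> sqrt lam * exp (pi * lam * v\<^sup>2) * ((1 + exp 1 * exp_abs_sum) * exp (pi * V + pi / 4) * exp (- (3 * pi * lam)))"
proof -
  have q: "0 < q" "q < 1"
    using lam by (simp_all add: q_def)
  have "2 * pi * (2 * lam) \<le> 2 * pi * (real n / lam)"
    using lam n by (intro mult_left_mono) (auto simp: le_divide_eq power2_eq_square)
  then have 1: "exp (- (2 * pi * real n / lam)) \<le> exp (- (4 * pi * lam))"
    by simp
  have 2: "1 / (1 - q) \<le> exp (pi * lam)"
  proof -
    \<comment> \<open>\<open>1 - q\<close> is of order \<open>1 / lam\<close>, so its reciprocal grows only linearly in \<open>lam\<close>.\<close>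
    have "(1 + pi / lam) * q \<le> exp (pi / lam) * q"
      using q by (intro mult_right_mono exp_ge_add_one_self) auto
    also have "exp (pi / lam) * q = 1"
      by (simp add: q_def flip: exp_add)
    finally have "1 \<le> (1 + lam / pi) * (1 - q)"
      using lam by (simp add: field_simps)
    then have "1 / (1 - q) \<le> 1 + lam / pi"
      using q by (simp add: divide_le_eq)
    also have "lam / pi \<le> pi * lam"
    proof -
      have "1 * 1 \<le> pi * pi" by (rule mult_mono) (use pi_gt3 in auto)
      then have "1 / pi \<le> pi" by (simp add: divide_le_eq)
      then show ?thesis using lam mult_right_mono[of "1 / pi" pi lam] by simp
    qed
    then have "1 + lam / pi \<le> exp (pi * lam)"
      using exp_ge_add_one_self[of "pi * lam"] by linarith
    finally show ?thesis .
  qed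
  obtain \<alpha> where \<alpha>: "theta lam 0 (v - 1 / (2 * lam)) = sqrt lam * exp (pi * lam * (v - 1 / (2 * lam))\<^sup>2) * (1 + \<alpha>)"
      "\<bar>\<alpha>\<bar> \<le> exp (1 - pi * lam) * exp_abs_sum"
    using theta_0_estimate[OF lam] by blast
  have "exp (1 - pi * lam) * exp_abs_sum \<le> exp 1 * exp_abs_sum"
    using lam exp_abs_sum_nonneg by (intro mult_right_mono) auto
  then have \<alpha>_le: "1 + \<alpha> \<le> 1 + exp 1 * exp_abs_sum"
    using \<alpha>(2) by linarith
  have "pi * lam * (v - 1 / (2 * lam))\<^sup>2 = pi * lam * v\<^sup>2 + (pi * - v + pi / (4 * lam))"
    using lam by (simp add: field_simps power2_eq_square)
  also have "\<dots> \<le> pi * lam * v\<^sup>2 + (pi * V + pi / 4)"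
    using v lam by (intro add_mono mult_left_mono divide_left_mono) auto
  finally have "exp (pi * lam * (v - 1 / (2 * lam))\<^sup>2) \<le> exp (pi * lam * v\<^sup>2) * exp (pi * V + pi / 4)"
    by (simp flip: exp_add)
  then have E: "sqrt lam * exp (pi * lam * (v - 1 / (2 * lam))\<^sup>2)
      \<le> sqrt lam * (exp (pi * lam * v\<^sup>2) * exp (pi * V + pi / 4))"
    using lam by (intro mult_left_mono) auto
  define T where "T = sqrt lam * (exp (pi * lam * v\<^sup>2) * exp (pi * V + pi / 4)) * (1 + exp 1 * exp_abs_sum)"
  have "sqrt lam * exp (pi * lam * (v - 1 / (2 * lam))\<^sup>2) * (1 + \<alpha>)
      \<le> sqrt lam * exp (pi * lam * (v - 1 / (2 * lam))\<^sup>2) * (1 + exp 1 * exp_abs_sum)"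
    by (rule mult_left_mono[OF \<alpha>_le]) (use lam in simp)
  also have "\<dots> \<le> T"
    unfolding T_def by (rule mult_right_mono[OF E]) (use exp_abs_sum_nonneg in simp)
  finally have T: "theta lam 0 (v - 1 / (2 * lam)) \<le> T"
    by (simp only: \<alpha>(1))
  have T0: "0 \<le> T"
    unfolding T_def using lam exp_abs_sum_nonneg by simp
  have "exp (- (2 * pi * real n / lam)) * (1 / (1 - q)) \<le> exp (- (4 * pi * lam)) * exp (pi * lam)"
    by (rule mult_mono[OF 1 2]) (use q in simp_all)
  also have "exp (- (4 * pi * lam)) * exp (pi * lam) = exp (- (3 * pi * lam))"
    unfolding exp_add[symmetric] by simp
  finally have K: "exp (- (2 * pi * real n / lam)) / (1 - q) \<le> exp (- (3 * pi * lam))"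
    by (simp only: times_divide_eq_right mult_1_right)
  have "exp (- (2 * pi * real n / lam)) / (1 - q) * theta lam 0 (v - 1 / (2 * lam))
      \<le> exp (- (2 * pi * real n / lam)) / (1 - q) * T"
    by (rule mult_left_mono[OF T]) (use q in simp)
  also have "\<dots> \<le> exp (- (3 * pi * lam)) * T"
    by (rule mult_right_mono[OF K T0])
  also have "\<dots> = sqrt lam * exp (pi * lam * v\<^sup>2) * ((1 + exp 1 * exp_abs_sum) * exp (pi * V + pi / 4) * exp (- (3 * pi * lam)))"
    unfolding T_def by (simp only: mult_ac)
  finally show ?thesis .
qed

lemma cancel_main_factors:
  fixes Q M :: real
  assumes "Q \<noteq> 0" "M \<noteq> 0" "Q * (M * X) = Q * (M * (c + \<alpha>) + d)"
  shows "X = c + (\<alpha> + d / M)"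
proof -
  have "M * X = M * (c + \<alpha>) + d"
    using assms(1,3) by simp
  then have "X = (M * (c + \<alpha>) + d) / M"
    using assms(2) by (simp add: field_simps)
  then show ?thesis
    using assms(2) by (simp add: add_divide_distrib)
qed

text \<open>Here \<open>\<beta>\<close> is the relative error of \<open>(q;q)\<^sub>\<infinity>\<close>, by which the series is
divided, \<open>c\<close> the main term and \<open>\<delta>\<close> the error of the theta series.\<close>

lemma quotient_error_bound:
  fixes \<beta> \<delta> c e :: real
  assumes "\<bar>\<beta>\<bar> \<le> 1 / 2" "\<bar>c\<bar> \<le> 1" "(1 + \<beta>) * (c + e) = c + \<delta>"
  shows "\<bar>e\<bar> \<le> 2 * (\<bar>\<delta>\<bar> + \<bar>\<beta>\<bar>)"
proof -
  have "(1 + \<beta>) * e = \<delta> - \<beta> * c"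
    using assms(3) by (simp add: algebra_simps)
  moreover have "\<bar>\<beta> * c\<bar> \<le> \<bar>\<beta>\<bar>"
    using assms(2) by (simp add: abs_mult mult_left_le)
  ultimately have "\<bar>(1 + \<beta>) * e\<bar> \<le> \<bar>\<delta>\<bar> + \<bar>\<beta>\<bar>"
    using abs_triangle_ineq4[of \<delta> "\<beta> * c"] by simp
  moreover have "1 / 2 * \<bar>e\<bar> \<le> \<bar>1 + \<beta>\<bar> * \<bar>e\<bar>"
    using assms(1) by (intro mult_right_mono) auto
  ultimately show ?thesis by (simp add: abs_mult)
qed

text \<open>The three summands bound the relative errors of the theta series, of the perturbation and of
\<open>(q;q)\<^sub>\<infinity>\<close>; the factor 2 comes from the division by \<open>(q;q)\<^sub>\<infinity>\<close>.\<close>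

definition error_const :: "real \<Rightarrow> real" where
  "error_const V = 2 * (exp 2 * exp_abs_sum + (1 + exp 1 * exp_abs_sum) * exp (pi * V + pi / 4) + exp 3 * exp_abs_sum)"

text \<open>Both error bounds combine three relative errors: \<open>\<alpha>\<close> from the theta series, \<open>\<beta>\<close>
from \<open>(q;q)\<^sub>\<infinity>\<close>, and \<open>d / M\<close> from replacing the finite products by their limit.
The prefactor in the theorem is the quotient of the leading term of the theta series and that of
\<open>(q;q)\<^sub>\<infinity>\<close>.\<close>

lemma theta_0_ramanujan_error:
  fixes lam v V q z E1 :: real and n :: nat
  assumes lam: "lam \<ge> 1" and n: "2 * lam\<^sup>2 \<le> real n" and v: "\<bar>v\<bar> \<le> V"
    and small: "exp (3 - 2 * pi * lam) * exp_abs_sum \<le> 1 / 2"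
    and q_def: "q = exp (- (pi / lam))" and z_def: "z = exp (2 * pi * v)"
    and E: "ramanujan_entire q (complex_of_real (- (q powi (- 4 * int n) * z))) =
    complex_of_real (exp (pi * lam * (v + 2 * real n / lam)\<^sup>2 + pi * lam / 6 - pi / (24 * lam))
      * (1 / sqrt 2) * (1 + E1))"
  shows "\<bar>E1\<bar> \<le> error_const V * exp (- (pi * lam))"
proof -
  have q: "0 < q" "q < 1"
    using lam by (simp_all add: q_def)
  have lam0: "lam > 0" using lam by simp
  obtain \<beta> where \<beta>: "qpochhammer_fin q \<longlonglongrightarrow> sqrt (2 * lam) * exp (pi / (24 * lam) - pi * lam / 6) * (1 + \<beta>)"
      "\<bar>\<beta>\<bar> \<le> exp (3 - 2 * pi * lam) * exp_abs_sum"
    using euler_function_asymptotics[OF lam] unfolding q_def by blast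
  \<comment> \<open>\<open>P\<close> is \<open>(q;q)\<^sub>\<infinity>\<close>, \<open>M\<close> the main part of the theta series, \<open>Q\<close> the factor from recentring.\<close>
  define P where "P = sqrt (2 * lam) * exp (pi / (24 * lam) - pi * lam / 6) * (1 + \<beta>)"
  define M where "M = sqrt lam * exp (pi * lam * v\<^sup>2)"
  define Q where "Q = exp (4 * pi * (real n)\<^sup>2 / lam + 4 * pi * real n * v)"
  define R where "R = (\<Sum>k. q ^ (k\<^sup>2) * (cos (2 * pi * 0) * (q powi (- 4 * int n) * z)) ^ k / qpochhammer_fin q k)"
  define D where "D = (1 + exp 1 * exp_abs_sum) * exp (pi * V + pi / 4) * exp (- (3 * pi * lam))"
  obtain d where d: "P * R = Q * (theta lam 0 v + d)"
      "\<bar>d\<bar> \<le> exp (- (2 * pi * real n / lam)) / (1 - q) * theta lam 0 (v - 1 / (2 * lam))"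
    using ramanujan_series_eq_theta[OF lam0, of 0 q P n v] \<beta>(1) q_def unfolding P_def Q_def R_def z_def by auto
  have dM: "\<bar>d\<bar> \<le> M * D"
    using d(2) perturbation_bound[OF lam n v q_def] unfolding M_def D_def by linarith
  have M: "M > 0" using lam by (simp add: M_def)
  obtain \<alpha> where \<alpha>: "theta lam 0 v = M * (1 + \<alpha>)" "\<bar>\<alpha>\<bar> \<le> exp (1 - pi * lam) * exp_abs_sum"
    using theta_0_estimate[OF lam] unfolding M_def by blast
  have R: "R = exp (pi * lam * (v + 2 * real n / lam)\<^sup>2 + pi * lam / 6 - pi / (24 * lam)) * (1 / sqrt 2) * (1 + E1)"
    using E unfolding ramanujan_entire_of_real[OF q] R_def by (simp only: of_real_eq_iff) simp
  have "pi * lam * (v + 2 * real n / lam)\<^sup>2 = 4 * pi * (real n)\<^sup>2 / lam + 4 * pi * real n * v + pi * lam * v\<^sup>2"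
    using lam by (simp add: field_simps power2_eq_square)
  then have "P * R = Q * (M * ((1 + \<beta>) * (1 + E1)))"
    unfolding P_def R Q_def M_def by (simp add: real_sqrt_mult exp_add exp_diff)
  then have "(1 + \<beta>) * (1 + E1) = 1 + (\<alpha> + d / M)"
    using d(1) M unfolding \<alpha>(1) by (intro cancel_main_factors[of Q M]) (auto simp: Q_def)
  then have "\<bar>E1\<bar> \<le> 2 * (\<bar>\<alpha> + d / M\<bar> + \<bar>\<beta>\<bar>)"
    using \<beta>(2) small by (intro quotient_error_bound[of \<beta> 1]) auto
  also have "\<bar>\<alpha> + d / M\<bar> \<le> \<bar>\<alpha>\<bar> + D"
  proof -
    have "\<bar>d / M\<bar> \<le> D" using dM M by (simp add: abs_divide divide_le_eq mult.commute)
    then show ?thesis by linarith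
  qed
  also have "\<bar>\<alpha>\<bar> \<le> exp 2 * exp_abs_sum * exp (- (pi * lam))"
  proof -
    have "exp (1 - pi * lam) \<le> exp 2 * exp (- (pi * lam))" by (simp flip: exp_add)
    from mult_right_mono[OF this exp_abs_sum_nonneg] show ?thesis using \<alpha>(2) by (simp add: mult_ac)
  qed
  also have "\<bar>\<beta>\<bar> \<le> exp 3 * exp_abs_sum * exp (- (pi * lam))"
  proof -
    have "exp (3 - 2 * pi * lam) \<le> exp 3 * exp (- (pi * lam))" using lam by (simp flip: exp_add)
    from mult_right_mono[OF this exp_abs_sum_nonneg] show ?thesis using \<beta>(2) by (simp add: mult_ac)
  qed
  also have "D \<le> (1 + exp 1 * exp_abs_sum) * exp (pi * V + pi / 4) * exp (- (pi * lam))"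
    unfolding D_def using exp_abs_sum_nonneg lam by (intro mult_left_mono mult_nonneg_nonneg) auto
  finally show ?thesis
    by (simp add: error_const_def algebra_simps)
qed

text \<open>The alternating theta series is smaller than the ordinary one by the factor
\<open>exp (- \<pi> lam / 4)\<close>, while the perturbation is bounded by the ordinary one. Of the factor
\<open>exp (- 3 \<pi> lam)\<close> in the perturbation at least \<open>exp (- 2 \<pi> lam)\<close> survives.\<close>

lemma theta_half_ramanujan_error:
  fixes lam v V q z E2 :: real and n :: nat
  assumes lam: "lam \<ge> 1" and n: "2 * lam\<^sup>2 \<le> real n" and v: "\<bar>v\<bar> \<le> V"
    and small: "exp (3 - 2 * pi * lam) * exp_abs_sum \<le> 1 / 2"
    and q_def: "q = exp (- (pi / lam))" and z_def: "z = exp (2 * pi * v)"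
    and E: "ramanujan_entire q (complex_of_real (q powi (- 4 * int n) * z)) =
    complex_of_real (exp (pi * lam * (v + 2 * real n / lam)\<^sup>2 - pi * lam / 12 - pi / (24 * lam))
      * sqrt 2 * (cos (pi * lam * v) + E2))"
  shows "\<bar>E2\<bar> \<le> error_const V * exp (- (2 * pi * lam))"
proof -
  have q: "0 < q" "q < 1"
    using lam by (simp_all add: q_def)
  have lam0: "lam > 0" using lam by simp
  obtain \<beta> where \<beta>: "qpochhammer_fin q \<longlonglongrightarrow> sqrt (2 * lam) * exp (pi / (24 * lam) - pi * lam / 6) * (1 + \<beta>)"
      "\<bar>\<beta>\<bar> \<le> exp (3 - 2 * pi * lam) * exp_abs_sum"
    using euler_function_asymptotics[OF lam] unfolding q_def by blast
  define P where "P = sqrt (2 * lam) * exp (pi / (24 * lam) - pi * lam / 6) * (1 + \<beta>)"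
  define M where "M = 2 * sqrt lam * exp (pi * lam * v\<^sup>2 - pi * lam / 4)"
  define Q where "Q = exp (4 * pi * (real n)\<^sup>2 / lam + 4 * pi * real n * v)"
  define R where "R = (\<Sum>k. q ^ (k\<^sup>2) * (cos (2 * pi * (1 / 2)) * (q powi (- 4 * int n) * z)) ^ k / qpochhammer_fin q k)"
  define D where "D = (1 + exp 1 * exp_abs_sum) * exp (pi * V + pi / 4) * exp (- (3 * pi * lam))"
  obtain d where d: "P * R = Q * (theta lam (1 / 2) v + d)"
      "\<bar>d\<bar> \<le> exp (- (2 * pi * real n / lam)) / (1 - q) * theta lam 0 (v - 1 / (2 * lam))"
    using ramanujan_series_eq_theta[OF lam0, of "1 / 2" q P n v] \<beta>(1) q_def unfolding P_def Q_def R_def z_def by auto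
  have M: "M > 0" using lam by (simp add: M_def)
  have D: "D \<ge> 0" using exp_abs_sum_nonneg by (simp add: D_def)
  have "\<bar>d\<bar> \<le> sqrt lam * exp (pi * lam * v\<^sup>2) * D"
    using d(2) perturbation_bound[OF lam n v q_def] unfolding D_def by linarith
  also have "exp (pi * lam * v\<^sup>2) \<le> exp (pi * lam * v\<^sup>2 - pi * lam / 4) * exp (pi * lam)"
    using lam by (simp flip: exp_add)
  also have "sqrt lam * (exp (pi * lam * v\<^sup>2 - pi * lam / 4) * exp (pi * lam)) * D \<le> M * (exp (pi * lam) * D)"
    using lam D by (simp add: M_def)
  finally have dM: "\<bar>d\<bar> \<le> M * (exp (pi * lam) * D)"
    using lam D by (simp add: mult_left_mono mult_right_mono)
  obtain \<alpha> where \<alpha>: "theta lam (1 / 2) v = M * (cos (pi * lam * v) + \<alpha>)" "\<bar>\<alpha>\<bar> \<le> exp (2 - 2 * pi * lam) * exp_abs_sum"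
    using theta_half_estimate[OF lam] unfolding M_def by blast
  have "- (cos (2 * pi * (1 / 2)) * (q powi (- 4 * int n) * z)) = q powi (- 4 * int n) * z"
    by simp
  from ramanujan_entire_of_real[OF q, of "cos (2 * pi * (1 / 2)) * (q powi (- 4 * int n) * z)", unfolded this]
  have R: "R = exp (pi * lam * (v + 2 * real n / lam)\<^sup>2 - pi * lam / 12 - pi / (24 * lam)) * sqrt 2 * (cos (pi * lam * v) + E2)"
    using E unfolding R_def by (simp only: of_real_eq_iff)
  have "pi * lam * (v + 2 * real n / lam)\<^sup>2 = 4 * pi * (real n)\<^sup>2 / lam + 4 * pi * real n * v + pi * lam * v\<^sup>2"
    using lam by (simp add: field_simps power2_eq_square)
  then have "(pi / (24 * lam) - pi * lam / 6) + (pi * lam * (v + 2 * real n / lam)\<^sup>2 - pi * lam / 12 - pi / (24 * lam))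
      = (4 * pi * (real n)\<^sup>2 / lam + 4 * pi * real n * v) + (pi * lam * v\<^sup>2 - pi * lam / 4)"
    by simp
  then have "exp (pi / (24 * lam) - pi * lam / 6) * exp (pi * lam * (v + 2 * real n / lam)\<^sup>2 - pi * lam / 12 - pi / (24 * lam))
      = Q * exp (pi * lam * v\<^sup>2 - pi * lam / 4)"
    unfolding Q_def by (simp only: exp_add[symmetric])
  moreover have "sqrt (2 * lam) * sqrt 2 = 2 * sqrt lam"
    by (simp add: real_sqrt_mult)
  moreover have "P * R = (sqrt (2 * lam) * sqrt 2) * (exp (pi / (24 * lam) - pi * lam / 6) * exp (pi * lam * (v + 2 * real n / lam)\<^sup>2 - pi * lam / 12 - pi / (24 * lam)))
      * ((1 + \<beta>) * (cos (pi * lam * v) + E2))"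
    unfolding P_def R by (simp only: mult_ac)
  ultimately have "P * R = Q * (M * ((1 + \<beta>) * (cos (pi * lam * v) + E2)))"
    unfolding M_def by (simp only: mult_ac)
  then have "(1 + \<beta>) * (cos (pi * lam * v) + E2) = cos (pi * lam * v) + (\<alpha> + d / M)"
    using d(1) M unfolding \<alpha>(1) by (intro cancel_main_factors[of Q M]) (auto simp: Q_def)
  then have "\<bar>E2\<bar> \<le> 2 * (\<bar>\<alpha> + d / M\<bar> + \<bar>\<beta>\<bar>)"
    using \<beta>(2) small by (intro quotient_error_bound[of \<beta> "cos (pi * lam * v)"]) auto
  also have "\<bar>\<alpha> + d / M\<bar> \<le> \<bar>\<alpha>\<bar> + exp (pi * lam) * D"
  proof -
    have "\<bar>d / M\<bar> \<le> exp (pi * lam) * D" using dM M by (simp add: abs_divide divide_le_eq mult.commute)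
    then show ?thesis by linarith
  qed
  also have "\<bar>\<alpha>\<bar> \<le> exp 2 * exp_abs_sum * exp (- (2 * pi * lam))"
    using \<alpha>(2) by (simp add: exp_diff exp_minus field_simps)
  also have "\<bar>\<beta>\<bar> \<le> exp 3 * exp_abs_sum * exp (- (2 * pi * lam))"
    using \<beta>(2) by (simp add: exp_diff exp_minus field_simps)
  also have "exp (pi * lam) * D = (1 + exp 1 * exp_abs_sum) * exp (pi * V + pi / 4) * exp (- (2 * pi * lam))"
  proof -
    have "exp (pi * lam) * exp (- (3 * pi * lam)) = exp (- (2 * pi * lam))" by (simp flip: exp_add)
    then show ?thesis unfolding D_def by (simp add: mult_ac)
  qed
  finally show ?thesis
    by (simp add: error_const_def algebra_simps)
qed

section \<open>Admissible scales\<close>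

text \<open>Growth faster than \<open>ln n\<close> enters only through \<open>lam n \<rightarrow> \<infinity>\<close>, and
\<open>n / (lam n)\<^sup>2 \<rightarrow> \<infinity>\<close> only through \<open>n \<ge> 2 (lam n)\<^sup>2\<close> for large
\<open>n\<close>.\<close>

lemma admissible_scale_at_top:
  assumes "admissible_scale lam"
  shows "filterlim lam at_top sequentially"
proof (rule filterlim_at_top_mono)
  show "filterlim (\<lambda>n. ln (real n)) at_top sequentially"
    by (intro filterlim_compose[OF ln_at_top] filterlim_real_sequentially)
  have "\<forall>\<^sub>F n in sequentially. 1 \<le> lam n / ln (real n)"
    using assms unfolding admissible_scale_def filterlim_at_top by blast
  moreover have "\<forall>\<^sub>F n in sequentially. (2::nat) \<le> n"
    by (rule eventually_ge_at_top)
  ultimately show "\<forall>\<^sub>F n in sequentially. ln (real n) \<le> lam n"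
    by eventually_elim (auto simp: le_divide_eq split: if_splits)
qed

lemma admissible_scale_eventually:
  assumes "admissible_scale lam"
  shows "\<forall>\<^sub>F n in sequentially. 1 \<le> n \<and> 1 \<le> lam n \<and> 2 * (lam n)\<^sup>2 \<le> real n \<and>
    exp (3 - 2 * pi * lam n) * exp_abs_sum \<le> 1 / 2"
proof -
  have lim: "filterlim lam at_top sequentially"
    by (rule admissible_scale_at_top[OF assms])
  have "((\<lambda>x. exp (3 - 2 * pi * x) * exp_abs_sum) \<longlongrightarrow> 0) at_top"
  proof -
    have "filterlim (\<lambda>x. - 3 + 2 * pi * x) at_top at_top"
      by (intro filterlim_tendsto_add_at_top[OF tendsto_const]
          filterlim_tendsto_pos_mult_at_top[OF tendsto_const _ filterlim_ident]) auto
    then have "filterlim (\<lambda>x. 3 - 2 * pi * x) at_bot at_top"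
      by (simp add: filterlim_uminus_at_top)
    from filterlim_compose[OF exp_at_bot this] show ?thesis
      by (intro tendsto_mult_left_zero) simp
  qed
  then have "\<forall>\<^sub>F x in at_top. exp (3 - 2 * pi * x) * exp_abs_sum < 1 / 2"
    by (rule order_tendstoD) simp
  then have "\<forall>\<^sub>F n in sequentially. exp (3 - 2 * pi * lam n) * exp_abs_sum < 1 / 2"
    using lim by (rule eventually_compose_filterlim)
  moreover have "\<forall>\<^sub>F n in sequentially. 1 \<le> lam n"
    using lim unfolding filterlim_at_top by blast
  moreover have "\<forall>\<^sub>F n in sequentially. 2 \<le> real n / (lam n)\<^sup>2"
    using assms unfolding admissible_scale_def filterlim_at_top by blast
  ultimately show ?thesis
    using eventually_ge_at_top[of "1::nat"]
    by eventually_elim (auto simp: le_divide_eq)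
qed

lemma bigo_uniform:
  fixes E g :: "nat \<Rightarrow> real \<Rightarrow> real"
  assumes "\<forall>\<^sub>F n in sequentially. \<forall>v\<in>K. \<bar>E n v\<bar> \<le> C * \<bar>g n v\<bar>"
  shows "(\<lambda>(n, v). E n v) \<in> O[sequentially \<times>\<^sub>F principal K](\<lambda>(n, v). g n v)"
proof (rule bigoI)
  show "\<forall>\<^sub>F x in sequentially \<times>\<^sub>F principal K. norm (case x of (n, v) \<Rightarrow> E n v) \<le> C * norm (case x of (n, v) \<Rightarrow> g n v)"
    by (rule eventually_mono[OF eventually_prodI[OF assms, of "\<lambda>v. v \<in> K"]])
      (auto simp: eventually_principal)
qed

text \<open>The prefactors do not vanish and the function values are real, so the error terms can be defined by
solving the two equations. The bounds above then hold as soon as \<open>n\<close> is large, with a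
constant that depends on \<open>K\<close> only through the bound \<open>V\<close> for its elements.\<close>

theorem corollary3p3:
  fixes lam :: "nat \<Rightarrow> real"
  assumes "admissible_scale lam"
  shows "\<exists>E1 E2 :: nat \<Rightarrow> real \<Rightarrow> real.
    (\<forall>n\<ge>1. \<forall>v::real.
       let z = exp (2 * pi * v); q = exp (- (pi / lam n)) in
         ramanujan_entire q (complex_of_real (- (q powi (- 4 * int n) * z))) =
           complex_of_real
             (exp (pi * lam n * (v + 2 * real n / lam n)\<^sup>2 + pi * lam n / 6 - pi / (24 * lam n))
              * (1 / sqrt 2) * (1 + E1 n v)) \<and>
         ramanujan_entire q (complex_of_real (q powi (- 4 * int n) * z)) =
           complex_of_real
             (exp (pi * lam n * (v + 2 * real n / lam n)\<^sup>2 - pi * lam n / 12 - pi / (24 * lam n))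
              * sqrt 2 * (cos (pi * lam n * v) + E2 n v))) \<and>
    (\<forall>K. compact K \<longrightarrow>
       (\<lambda>(n, v). E1 n v) \<in> O[sequentially \<times>\<^sub>F principal K](\<lambda>(n, v). exp (- (pi * lam n))) \<and>
       (\<lambda>(n, v). E2 n v) \<in> O[sequentially \<times>\<^sub>F principal K](\<lambda>(n, v). exp (- (2 * pi * lam n))))"
proof -
  define q w where "q = (\<lambda>n. exp (- (pi / lam n)))"
    and "w = (\<lambda>n v. q n powi (- 4 * int n) * exp (2 * pi * v))"
  define M1 M2 where
    "M1 = (\<lambda>n v. exp (pi * lam n * (v + 2 * real n / lam n)\<^sup>2 + pi * lam n / 6 - pi / (24 * lam n)) * (1 / sqrt 2))"
    and "M2 = (\<lambda>n v. exp (pi * lam n * (v + 2 * real n / lam n)\<^sup>2 - pi * lam n / 12 - pi / (24 * lam n)) * sqrt 2)"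
  define E1 E2 where
    "E1 = (\<lambda>n v. Re (ramanujan_entire (q n) (complex_of_real (- w n v))) / M1 n v - 1)"
    and "E2 = (\<lambda>n v. Re (ramanujan_entire (q n) (complex_of_real (w n v))) / M2 n v - cos (pi * lam n * v))"
  have M: "M1 n v \<noteq> 0" "M2 n v \<noteq> 0" for n v
    by (simp_all add: M1_def M2_def)
  have real_valued: "ramanujan_entire (q n) (complex_of_real x) = complex_of_real (Re (ramanujan_entire (q n) (complex_of_real x)))"
    if "n \<ge> 1" for n x
  proof -
    have "lam n > 0" using assms that by (simp add: admissible_scale_def)
    then have "0 < q n" "q n < 1" by (simp_all add: q_def)
    from ramanujan_entire_of_real[OF this, of "- x"] show ?thesis by simp
  qed
  have eq1: "ramanujan_entire (q n) (complex_of_real (- w n v)) = complex_of_real (M1 n v * (1 + E1 n v))"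
    and eq2: "ramanujan_entire (q n) (complex_of_real (w n v)) = complex_of_real (M2 n v * (cos (pi * lam n * v) + E2 n v))"
    if "n \<ge> 1" for n v
    by (subst real_valued[OF that], simp add: E1_def E2_def M)+
  have "(\<lambda>(n, v). E1 n v) \<in> O[sequentially \<times>\<^sub>F principal K](\<lambda>(n, v). exp (- (pi * lam n)))"
    "(\<lambda>(n, v). E2 n v) \<in> O[sequentially \<times>\<^sub>F principal K](\<lambda>(n, v). exp (- (2 * pi * lam n)))" if K: "compact K" for K
  proof -
    obtain V where V: "\<And>v. v \<in> K \<Longrightarrow> \<bar>v\<bar> \<le> V"
      using compact_imp_bounded[OF K] by (auto simp: bounded_iff)
    note ev = admissible_scale_eventually[OF assms]
    show "(\<lambda>(n, v). E1 n v) \<in> O[sequentially \<times>\<^sub>F principal K](\<lambda>(n, v). exp (- (pi * lam n)))"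
    proof (rule bigo_uniform[where C = "error_const V"])
      show "\<forall>\<^sub>F n in sequentially. \<forall>v\<in>K. \<bar>E1 n v\<bar> \<le> error_const V * \<bar>exp (- (pi * lam n))\<bar>"
        using ev
      proof eventually_elim
        case (elim n)
        have "\<bar>E1 n v\<bar> \<le> error_const V * exp (- (pi * lam n))" if "v \<in> K" for v
          using elim eq1[of n v] V[OF that]
          by (intro theta_0_ramanujan_error[where q = "q n" and z = "exp (2 * pi * v)" and n = n and v = v])
            (simp_all only: q_def w_def M1_def)
        then show ?case by simp
      qed
    qed
    show "(\<lambda>(n, v). E2 n v) \<in> O[sequentially \<times>\<^sub>F principal K](\<lambda>(n, v). exp (- (2 * pi * lam n)))"
    proof (rule bigo_uniform[where C = "error_const V"])
      show "\<forall>\<^sub>F n in sequentially. \<forall>v\<in>K. \<bar>E2 n v\<bar> \<le> error_const V * \<bar>exp (- (2 * pi * lam n))\<bar>"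
        using ev
      proof eventually_elim
        case (elim n)
        have "\<bar>E2 n v\<bar> \<le> error_const V * exp (- (2 * pi * lam n))" if "v \<in> K" for v
          using elim eq2[of n v] V[OF that]
          by (intro theta_half_ramanujan_error[where q = "q n" and z = "exp (2 * pi * v)" and n = n and v = v])
            (simp_all only: q_def w_def M2_def)
        then show ?case by simp
      qed
    qed
  qed
  moreover have "\<forall>n\<ge>1. \<forall>v::real.
       let z = exp (2 * pi * v); q = exp (- (pi / lam n)) in
         ramanujan_entire q (complex_of_real (- (q powi (- 4 * int n) * z))) =
           complex_of_real
             (exp (pi * lam n * (v + 2 * real n / lam n)\<^sup>2 + pi * lam n / 6 - pi / (24 * lam n))
              * (1 / sqrt 2) * (1 + E1 n v)) \<and>
         ramanujan_entire q (complex_of_real (q powi (- 4 * int n) * z)) =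
           complex_of_real
             (exp (pi * lam n * (v + 2 * real n / lam n)\<^sup>2 - pi * lam n / 12 - pi / (24 * lam n))
              * sqrt 2 * (cos (pi * lam n * v) + E2 n v))"
    using eq1 eq2 by (simp only: Let_def q_def w_def M1_def M2_def) blast
  ultimately show ?thesis by blast
qed

end
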